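(* Let $l$ leaders ($2\le l<n$) move with a common velocity $\mathbf v^*(t)$ which is bounded and uniformly continuous, so that the target formation $\mathbf p^*(t)$ satisfies $\dot{\mathbf p}^*=\mathbf 1_n\otimes\mathbf v^*$, and let the followers $i=l+1,\dots,n$ obey $\dot{\mathbf p}_i=\mathbf u_i+\mathbf d_i$ under the displacement-based adaptive control law $$\mathbf u_i=-\sum_{j\in\mathcal N_i}\gamma_{ij}\mathbf P_{\mathbf g_{ij}^*}\,\mathrm{sgn}(\mathbf q_{ij}),\qquad \mathbf q_{ij}=\mathbf P_{\mathbf g_{ij}^*}(\mathbf p_i-\mathbf p_j),\qquad \dot\gamma_{ij}=\kappa\|\mathbf q_{ij}\|_1\quad((i,j)\in\mathcal E),$$ with $\gamma_{ij}(0)>0$ and $\kappa>0$, under the standing assumptions listed in the context. Let $\boldsymbol\delta=\mathbf p-\mathbf p^*$. Then for every Filippov solution on $[0,\infty)$: (i) $\boldsymbol\delta(t)\to\mathbf 0$ as $t\to+\infty$. (ii) There exists a constant vector $\boldsymbol\gamma^*=[\gamma_1^*,\dots,\gamma_m^*]^\top$ such that $\boldsymbol\gamma(t)=[\gamma_1(t),\dots,\gamma_m(t)]^\top\to\boldsymbol\gamma^*$ as $t\to+\infty$. (iii) If, additionally, $\gamma_k^*>\gamma_0':=(\beta+\|\mathbf v^*\|_\infty)\sqrt{\dfrac{dn}{\lambda_{\min}(\mathbf L_{ff}^* )}}$ for all $k=1,\dots,m$, and there exists a finite time $T$ such that $|\gamma_k(T)-\gamma_k^*|<\min_{k'}|\gamma_{k'}(T)-\gamma_0'|$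 for all $k=1,\dots,m$, then $\boldsymbol\delta(t)\to\mathbf 0$ in finite time, i.e. there is $T'<\infty$ with $\boldsymbol\delta(t)=\mathbf 0$ for all $t\ge T'$.
   Context: Setting. $d\ge 2$; $\mathcal G=(\mathcal V,\mathcal E)$ is an undirected graph without self-loops, $|\mathcal V|=n$, $|\mathcal E|=m$, edges indexed $e_1,\dots,e_m$ and arbitrarily oriented; $\mathcal N_i$ is the neighbor set of $i$. Agent $i$ has position $\mathbf p_i(t)\in\mathbb R^d$ (all in a common orientation), $\mathbf p=[\mathbf p_1^\top,\dots,\mathbf p_n^\top]^\top$. Agents $1,\dots,l$ are leaders, $l+1,\dots,n$ followers, $f=n-l$. Bearing rigidity. For a configuration with distinct points, $\mathbf z_{ij}=\mathbf p_j-\mathbf p_i$, $\mathbf g_{ij}=\mathbf z_{ij}/\|\mathbf z_{ij}\|$, and $\mathbf P_{\mathbf g}=\mathbf I_d-\mathbf g\mathbf g^\top$ for a unit vector $\mathbf g$; for an edge $e_k=(i,j)$ write $\mathbf g_k=\mathbf g_{ij}$. $\mathbf H=[h_{ki}]\in\mathbb R^{m\times n}$ is the incidence matrix ($h_{ki}=-1$ if $i$ is the start vertex of $e_k$, $+1$ if the end vertex, $0$ otherwise), $\bar{\mathbf H}=\mathbf H\otimes\mathbf I_d$. $\tilde{\mathbf R}_b=\mathrm{blkdiag}(\mathbf P_{\mathbf g_k})\bar{\mathbf H}$ and the bearing Laplacian is $\mathbf L_b=\tilde{\mathbf R}_b^\top\tilde{\mathbf R}_b$. The formation is infinitesimally bearing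 rigid in $\mathbb R^d$ if $\mathrm{rank}(\tilde{\mathbf R}_b)=dn-d-1$. Target formation. $\mathbf p^*(0)$ has distinct points and $(\mathcal G,\mathbf p^*(0))$ is infinitesimally bearing rigid in $\mathbb R^d$; $\mathbf p^*(t)=\mathbf p^*(0)+\mathbf 1_n\otimes\int_0^t\mathbf v^*(s)\,ds$, so its bearing vectors $\mathbf g_{ij}^*$ are constant. $\mathbf L_{ff}^*$ is the lower-right $df\times df$ (follower-follower) block of $\mathbf L_b$ evaluated at $\mathbf p^*$; it is known to be symmetric positive definite, with smallest eigenvalue $\lambda_{\min}(\mathbf L_{ff}^* )$. Leaders are at their target positions: $\mathbf p_i(t)=\mathbf p_i^*(t)$ for $i\le l$, $t\ge 0$. $\|\mathbf v^*\|_\infty$ means $\sup_{t\ge0}\|\mathbf v^*(t)\|_\infty$. Disturbance. $\mathbf d(t)=[\mathbf d_1(t)^\top,\dots,\mathbf d_n(t)^\top]^\top$ is bounded and uniformly continuous on $[0,\infty)$, and $\beta=\sup_{t\ge0}\|\mathbf d(t)\|_\infty>0$. It is assumed that there is no collision between agents ($\mathbf p_i(t)\ne\mathbf p_j(t)$ for $i\neq j$). Conventions. $\mathrm{sgn}$ acts componentwise, with $\mathrm{sgn}(0)=0$; there is one gain per undirected edge, $\gamma_{ij}=\gamma_{ji}=\gamma_k$ for $e_k=(i,j)$. Solutions are in the Filippov sense: for the state $\mathbf x=(\mathbf p_{l+1},\dots,\mathbf p_n,\boldsymbol\gamma)$ with closed-loop right-hand side $F(t,\mathbf x)$, a solution is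 a locally absolutely continuous function with $\dot{\mathbf x}\in K[F](t,\mathbf x)$ for almost every $t$, where $K[F](t,\mathbf x)=\bigcap_{\epsilon>0}\bigcap_{\mu(S)=0}\overline{\mathrm{co}}\,F(t,B(\mathbf x,\epsilon)\setminus S)$ and $\mu$ is Lebesgue measure. *)

theory Defs
  imports "HOL-Analysis.Analysis"
begin

section \<open>Vectors and matrices\<close>

text \<open>The overloaded \<^const>\<open>sgn\<close> on vectors is normalisation, not the
  componentwise sign. The supremum norm of a vector is the library's \<^const>\<open>infnorm\<close>.\<close>

definition sgn_comp :: "real^'d \<Rightarrow> real^'d" where
  "sgn_comp y = (\<chi> a. sgn (y $ a))"

definition norm1 :: "real^'d \<Rightarrow> real" where
  "norm1 y = (\<Sum>a\<in>UNIV. \<bar>y $ a\<bar>)"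

definition sup_infnorm :: "(real \<Rightarrow> 'a::euclidean_space) \<Rightarrow> real" where
  "sup_infnorm w = (SUP t\<in>{0..}. infnorm (w t))"

definition proj_orth :: "real^'d \<Rightarrow> real^'d^'d" where
  "proj_orth g = mat 1 - (\<chi> a b. g $ a * g $ b)"

text \<open>Rows and columns of block matrices are indexed by pairs (block, entry in the block).\<close>

definition kronecker ::
  "real^'n::finite^'m::finite \<Rightarrow> real^'c::finite^'r::finite \<Rightarrow> real^('n \<times> 'c)^('m \<times> 'r)" where
  "kronecker A B = (\<chi> r c. A $ fst r $ fst c * B $ snd r $ snd c)"

definition blkdiag :: "('m::finite \<Rightarrow> real^'d::finite^'d) \<Rightarrow> real^('m \<times> 'd)^('m \<times> 'd)" where
  "blkdiag P = (\<chi> r c. if fst r = fst c then P (fst r) $ snd r $ snd c else 0)"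

definition is_eigenvalue :: "real^'n^'n \<Rightarrow> real \<Rightarrow> bool" where
  "is_eigenvalue A \<mu> \<longleftrightarrow> (\<exists>y. y \<noteq> 0 \<and> A *v y = \<mu> *\<^sub>R y)"

definition lambda_min :: "real^'n^'n \<Rightarrow> real" where
  "lambda_min A = (LEAST \<mu>. is_eigenvalue A \<mu>)"

section \<open>Graphs and bearing rigidity\<close>

text \<open>An undirected graph on the vertex type \<^typ>\<open>'n\<close> is given by the enumeration \<open>e\<close> of its
  edges by \<^typ>\<open>'m\<close>, where \<open>e k = (i, j)\<close> carries the chosen orientation from \<open>i\<close> to \<open>j\<close>.\<close>

definition simple_graph :: "('m \<Rightarrow> 'n \<times> 'n) \<Rightarrow> bool" where
  "simple_graph e \<longleftrightarrow> (\<forall>k. fst (e k) \<noteq> snd (e k)) \<and> inj (\<lambda>k. {fst (e k), snd (e k)})"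

definition neighbors :: "('m \<Rightarrow> 'n \<times> 'n) \<Rightarrow> 'n \<Rightarrow> 'n set" where
  "neighbors e i = {j. \<exists>k. e k = (i, j) \<or> e k = (j, i)}"

definition edge_index :: "('m \<Rightarrow> 'n \<times> 'n) \<Rightarrow> 'n \<Rightarrow> 'n \<Rightarrow> 'm" where
  "edge_index e i j = (THE k. e k = (i, j) \<or> e k = (j, i))"

definition incidence :: "('m \<Rightarrow> 'n \<times> 'n) \<Rightarrow> real^'n::finite^'m::finite" where
  "incidence e = (\<chi> k i. if i = fst (e k) then -1 else if i = snd (e k) then 1 else 0)"

definition bearing :: "real^'d^'n \<Rightarrow> 'n \<Rightarrow> 'n \<Rightarrow> real^'d" where
  "bearing p i j = (p $ j - p $ i) /\<^sub>R norm (p $ j - p $ i)"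

definition rigidity_matrix ::
  "('m::finite \<Rightarrow> 'n::finite \<times> 'n) \<Rightarrow> real^'d::finite^'n \<Rightarrow> real^('n \<times> 'd)^('m \<times> 'd)" where
  "rigidity_matrix e p =
     blkdiag (\<lambda>k. proj_orth (bearing p (fst (e k)) (snd (e k)))) ** kronecker (incidence e) (mat 1)"

definition infinitesimally_bearing_rigid ::
  "('m::finite \<Rightarrow> 'n::finite \<times> 'n) \<Rightarrow> real^'d^'n \<Rightarrow> bool" where
  "infinitesimally_bearing_rigid e p \<longleftrightarrow>
     rank (rigidity_matrix e p) = CARD('d) * CARD('n) - CARD('d) - 1"

definition bearing_laplacian ::
  "('m::finite \<Rightarrow> 'n::finite \<times> 'n) \<Rightarrow> real^'d::finite^'n \<Rightarrow> real^('n \<times> 'd)^('n \<times> 'd)" where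
  "bearing_laplacian e p = transpose (rigidity_matrix e p) ** rigidity_matrix e p"

text \<open>A network with leaders and followers has as agents the elements of a sum type \<^typ>\<open>'l + 'f\<close>: leaders are
  tagged \<^const>\<open>Inl\<close>, followers \<^const>\<open>Inr\<close>.\<close>

definition follower_block ::
  "real^(('l::finite + 'f::finite) \<times> 'd::finite)^(('l + 'f) \<times> 'd) \<Rightarrow> real^('f \<times> 'd)^('f \<times> 'd)" where
  "follower_block A = (\<chi> r c. A $ (Inr (fst r), snd r) $ (Inr (fst c), snd c))"

definition followers :: "real^'d^('l::finite + 'f::finite) \<Rightarrow> real^'d^'f" where
  "followers p = (\<chi> i. p $ Inr i)"

definition configuration :: "real^'d^('l::finite + 'f::finite) \<Rightarrow> real^'d^'f \<Rightarrow> real^'d^('l + 'f)" where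
  "configuration pl pf = (\<chi> i. case i of Inl a \<Rightarrow> pl $ Inl a | Inr b \<Rightarrow> pf $ b)"

section \<open>Filippov solutions\<close>

definition abs_continuous_on_Icc :: "real \<Rightarrow> real \<Rightarrow> (real \<Rightarrow> 'a::real_normed_vector) \<Rightarrow> bool" where
  "abs_continuous_on_Icc a b x \<longleftrightarrow>
     (\<forall>\<epsilon>>0. \<exists>\<eta>>0. \<forall>I :: (real \<times> real) set.
        finite I \<and> (\<forall>(s, t)\<in>I. a \<le> s \<and> s \<le> t \<and> t \<le> b) \<and>
        pairwise (\<lambda>(s, t) (s', t'). {s<..<t} \<inter> {s'<..<t'} = {}) I \<and>
        (\<Sum>(s, t)\<in>I. t - s) < \<eta>
        \<longrightarrow> (\<Sum>(s, t)\<in>I. norm (x t - x s)) < \<epsilon>)"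

definition filippov_map :: "(real \<Rightarrow> 'a \<Rightarrow> 'a) \<Rightarrow> real \<Rightarrow> 'a \<Rightarrow> 'a::euclidean_space set" where
  "filippov_map F t x =
     (\<Inter>\<epsilon>\<in>{0<..}. \<Inter>S\<in>null_sets lebesgue. closure (convex hull (F t ` (ball x \<epsilon> - S))))"

definition filippov_solution ::
  "(real \<Rightarrow> 'a \<Rightarrow> 'a::euclidean_space) \<Rightarrow> (real \<Rightarrow> 'a) \<Rightarrow> bool" where
  "filippov_solution F x \<longleftrightarrow>
     (\<forall>b\<ge>0. abs_continuous_on_Icc 0 b x) \<and>
     (AE t in lebesgue. t \<ge> 0 \<longrightarrow>
        (\<exists>x'. (x has_vector_derivative x') (at t within {0..}) \<and> x' \<in> filippov_map F t (x t)))"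

section \<open>Closed loop\<close>

text \<open>\<open>ps\<close> is the target trajectory. It only moves by translations, so its bearing vectors are
  constant and are taken at time 0.\<close>

definition q_vec :: "(real \<Rightarrow> real^'d^'n) \<Rightarrow> real^'d^'n \<Rightarrow> 'n \<Rightarrow> 'n \<Rightarrow> real^'d" where
  "q_vec ps p i j = proj_orth (bearing (ps 0) i j) *v (p $ i - p $ j)"

definition control ::
  "('m::finite \<Rightarrow> 'n::finite \<times> 'n) \<Rightarrow> (real \<Rightarrow> real^'d^'n) \<Rightarrow> real^'m \<Rightarrow> real^'d^'n \<Rightarrow> 'n \<Rightarrow> real^'d"
  where
  "control e ps \<gamma> p i =
     - (\<Sum>j\<in>neighbors e i.
          \<gamma> $ edge_index e i j *\<^sub>R (proj_orth (bearing (ps 0) i j) *v sgn_comp (q_vec ps p i j)))"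

text \<open>The state consists of the follower positions and the gains, the leaders being at their
  target positions \<open>ps t\<close>.\<close>

definition closed_loop ::
  "('m::finite \<Rightarrow> ('l::finite + 'f::finite) \<times> ('l + 'f)) \<Rightarrow> (real \<Rightarrow> real^'d^('l + 'f)) \<Rightarrow>
   (real \<Rightarrow> real^'d^('l + 'f)) \<Rightarrow> real \<Rightarrow>
   real \<Rightarrow> (real^'d^'f) \<times> (real^'m) \<Rightarrow> (real^'d^'f) \<times> (real^'m)" where
  "closed_loop e ps d \<kappa> t x =
     (let p = configuration (ps t) (fst x) in
      (\<chi> i. control e ps (snd x) p (Inr i) + d t $ Inr i,
       \<chi> k. \<kappa> * norm1 (q_vec ps p (fst (e k)) (snd (e k)))))"

end

theory Submission
  imports Defs
begin

text \<open>
  The bearing Laplacian restricted to the followers is positive definite: by rigidity the null space of the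
  rigidity matrix consists of the translations and scalings of the formation, and fixing two distinct leaders
  excludes these. Let \<open>y\<close> be the error of the followers and \<open>q k\<close> its projection along edge \<open>k\<close>, so that
  \<open>\<Sum>k. norm1 (q k) \<ge> sqrt \<lambda> * norm y\<close> for the smallest eigenvalue \<open>\<lambda>\<close>. Although the right-hand side is
  discontinuous, its inner product with \<open>y\<close> is continuous at the current state, because \<open>q k $ a * sgn (q k $ a)\<close>
  does not see the jump of the sign; hence every Filippov velocity \<open>y'\<close> satisfies
  \<open>y \<bullet> y' \<le> (\<Sum>k. (\<gamma>0 - \<gamma> k) * norm1 (q k))\<close>, where \<open>\<gamma>0\<close> absorbs the disturbance and the leaders' velocity.
  Together with \<open>\<gamma>' k = \<kappa> * norm1 (q k)\<close> this makes \<open>(norm y)\<^sup>2 + (\<Sum>k. (\<gamma> k - \<gamma>0)\<^sup>2) / \<kappa>\<close> nonincreasing. So the gains,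
  which are nondecreasing, converge, and since \<open>y\<close> is Lipschitz and the total gain grows at a rate at least
  proportional to \<open>norm y\<close>, the error tends to zero. If the limit gains exceed \<open>\<gamma>0\<close>, then eventually
  \<open>norm y\<close> decreases at a rate bounded below until it vanishes.
\<close>

section \<open>Absolutely continuous functions\<close>

lemma abs_continuous_on_Icc_subinterval:
  assumes "abs_continuous_on_Icc a b x" "a \<le> c" "e \<le> b"
  shows "abs_continuous_on_Icc c e x"
  unfolding abs_continuous_on_Icc_def
proof (intro allI impI)
  fix \<epsilon> :: real assume "\<epsilon> > 0"
  with assms(1) obtain \<eta> where \<eta>: "\<eta> > 0" "\<And>I. finite I \<Longrightarrow>
      (\<forall>(s, t)\<in>I. a \<le> s \<and> s \<le> t \<and> t \<le> b) \<Longrightarrow>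
      pairwise (\<lambda>(s, t) (s', t'). {s<..<t} \<inter> {s'<..<t'} = {}) I \<Longrightarrow>
      (\<Sum>(s, t)\<in>I. t - s) < \<eta> \<Longrightarrow> (\<Sum>(s, t)\<in>I. norm (x t - x s)) < \<epsilon>"
    unfolding abs_continuous_on_Icc_def by meson
  show "\<exists>\<eta>>0. \<forall>I. finite I \<and> (\<forall>(s, t)\<in>I. c \<le> s \<and> s \<le> t \<and> t \<le> e) \<and>
      pairwise (\<lambda>(s, t) (s', t'). {s<..<t} \<inter> {s'<..<t'} = {}) I \<and> (\<Sum>(s, t)\<in>I. t - s) < \<eta> \<longrightarrow>
      (\<Sum>(s, t)\<in>I. norm (x t - x s)) < \<epsilon>"
  proof (intro exI[of _ \<eta>] conjI allI impI \<eta>(1))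
    fix I assume I: "finite I \<and> (\<forall>(s, t)\<in>I. c \<le> s \<and> s \<le> t \<and> t \<le> e) \<and>
      pairwise (\<lambda>(s, t) (s', t'). {s<..<t} \<inter> {s'<..<t'} = {}) I \<and> (\<Sum>(s, t)\<in>I. t - s) < \<eta>"
    have "\<forall>(s, t)\<in>I. a \<le> s \<and> s \<le> t \<and> t \<le> b"
      using I assms(2,3) by fastforce
    then show "(\<Sum>(s, t)\<in>I. norm (x t - x s)) < \<epsilon>" using I \<eta>(2)[of I] by blast
  qed
qed

text \<open>The summand \<open>t - s\<close> admits a Lipschitz dependence on time beside the
  variation of \<open>x\<close>. The sum over a family of intervals splits into the variation of
  \<open>x\<close> and the total length, and both can be made small.\<close>

lemma abs_continuous_on_Icc_dominated:
  fixes x :: "real \<Rightarrow> 'a::real_normed_vector" and f :: "real \<Rightarrow> 'b::real_normed_vector"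
  assumes x: "abs_continuous_on_Icc a b x"
    and dom: "\<And>s t. a \<le> s \<Longrightarrow> s \<le> t \<Longrightarrow> t \<le> b \<Longrightarrow> norm (f t - f s) \<le> C * (norm (x t - x s) + (t - s))"
  shows "abs_continuous_on_Icc a b f"
  unfolding abs_continuous_on_Icc_def
proof (intro allI impI)
  fix \<epsilon> :: real assume "\<epsilon> > 0"
  \<comment> \<open>\<open>C\<close> may have any sign; \<open>D\<close> is a positive bound for it,
    so that division by it is allowed.\<close>
  define D where "D = \<bar>C\<bar> + 1"
  have D: "D > 0" "C \<le> D" by (auto simp: D_def)
  have "\<epsilon> / (2 * D) > 0" using \<open>\<epsilon> > 0\<close> D by simp
  with x obtain \<eta> where \<eta>: "\<eta> > 0" "\<And>I. finite I \<Longrightarrow>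
      (\<forall>(s, t)\<in>I. a \<le> s \<and> s \<le> t \<and> t \<le> b) \<Longrightarrow>
      pairwise (\<lambda>(s, t) (s', t'). {s<..<t} \<inter> {s'<..<t'} = {}) I \<Longrightarrow>
      (\<Sum>(s, t)\<in>I. t - s) < \<eta> \<Longrightarrow> (\<Sum>(s, t)\<in>I. norm (x t - x s)) < \<epsilon> / (2 * D)"
    unfolding abs_continuous_on_Icc_def by meson
  show "\<exists>\<eta>>0. \<forall>I. finite I \<and> (\<forall>(s, t)\<in>I. a \<le> s \<and> s \<le> t \<and> t \<le> b) \<and>
      pairwise (\<lambda>(s, t) (s', t'). {s<..<t} \<inter> {s'<..<t'} = {}) I \<and> (\<Sum>(s, t)\<in>I. t - s) < \<eta> \<longrightarrow>
      (\<Sum>(s, t)\<in>I. norm (f t - f s)) < \<epsilon>"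
  \<comment> \<open>The minimum controls the variation of \<open>x\<close> through
    \<open>\<eta>\<close> and at the same time keeps the total length below
    \<open>\<epsilon> / (2 * D)\<close>.\<close>
  proof (intro exI[of _ "min \<eta> (\<epsilon> / (2 * D))"] conjI allI impI)
    show "min \<eta> (\<epsilon> / (2 * D)) > 0" using \<eta>(1) \<open>\<epsilon> / (2 * D) > 0\<close> by simp
    fix I assume I: "finite I \<and> (\<forall>(s, t)\<in>I. a \<le> s \<and> s \<le> t \<and> t \<le> b) \<and>
      pairwise (\<lambda>(s, t) (s', t'). {s<..<t} \<inter> {s'<..<t'} = {}) I \<and>
      (\<Sum>(s, t)\<in>I. t - s) < min \<eta> (\<epsilon> / (2 * D))"
    have "(\<Sum>(s, t)\<in>I. norm (f t - f s)) \<le> (\<Sum>(s, t)\<in>I. D * (norm (x t - x s) + (t - s)))"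
    proof (rule sum_mono, clarify)
      fix s t assume "(s, t) \<in> I"
      then have st: "a \<le> s" "s \<le> t" "t \<le> b" using I by auto
      have "C * (norm (x t - x s) + (t - s)) \<le> D * (norm (x t - x s) + (t - s))"
        using D st by (intro mult_right_mono) auto
      then show "norm (f t - f s) \<le> D * (norm (x t - x s) + (t - s))" using dom[OF st] by simp
    qed
    also have "\<dots> = D * ((\<Sum>(s, t)\<in>I. norm (x t - x s)) + (\<Sum>(s, t)\<in>I. t - s))"
      by (simp add: sum_distrib_left sum.distrib case_prod_unfold distrib_left)
    also have "\<dots> < D * (\<epsilon> / (2 * D) + \<epsilon> / (2 * D))"
      using D I \<eta>(2)[of I] by (intro mult_strict_left_mono add_strict_mono) auto
    also have "\<dots> = \<epsilon>" using D by (simp add: field_simps)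
    finally show "(\<Sum>(s, t)\<in>I. norm (f t - f s)) < \<epsilon>" .
  qed
qed

text \<open>Two members meet in a negligible set, so the lengths add up to the measure of the union,
  which lies in \<open>U\<close>. This bounds the total length of the intervals tagged in a null
  set.\<close>

lemma tagged_partial_division_length_le_measure:
  fixes p :: "(real \<times> real set) set"
  assumes p: "p tagged_partial_division_of {a..b}"
    and U: "\<And>x K. (x, K) \<in> p \<Longrightarrow> K \<subseteq> U" "U \<in> lmeasurable"
    and nd: "\<And>x K. (x, K) \<in> p \<Longrightarrow> Inf K < Sup K"
  shows "(\<Sum>(x, K)\<in>p. Sup K - Inf K) \<le> measure lebesgue U"
proof -
  have fin: "finite p" using p by (rule tagged_partial_division_ofD(1))
  have int: "\<exists>c d. K = {c..d} \<and> c < d" if xK: "(x, K) \<in> p" for x K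
  proof -
    obtain c d where cd: "K = {c..d}" using tagged_partial_division_ofD(4)[OF p xK] by auto
    have "x \<in> K" using p xK by (rule tagged_partial_division_ofD(2))
    then have "c \<le> d" using cd by auto
    with nd[OF xK] cd have "c < d" by (cases "c = d") auto
    with cd show ?thesis by blast
  qed
  have len: "Sup K - Inf K = measure lebesgue K" "K \<in> lmeasurable" if "(x, K) \<in> p" for x K
    using int[OF that] by auto
  have "(\<Sum>(x, K)\<in>p. Sup K - Inf K) = (\<Sum>z\<in>p. measure lebesgue (snd z))"
    using len by (intro sum.cong) auto
  also have "\<dots> = measure lebesgue (\<Union>(snd ` p))"
  proof (rule measure_negligible_finite_Union_image[symmetric])
    show "finite p" by fact
    show "snd z \<in> lmeasurable" if "z \<in> p" for z using len(2)[of "fst z" "snd z"] that by simp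
    show "pairwise (\<lambda>z w. negligible (snd z \<inter> snd w)) p"
    proof (rule pairwiseI)
      fix z w assume zw: "z \<in> p" "w \<in> p" "z \<noteq> w"
      have "interior (snd z) \<inter> interior (snd w) = {}"
        using tagged_partial_division_ofD(5)[OF p, of "fst z" "snd z" "fst w" "snd w"] zw by auto
      \<comment> \<open>A convex set with empty interior is negligible.\<close>
      moreover have "convex (snd z \<inter> snd w)"
        using int[of "fst z" "snd z"] int[of "fst w" "snd w"] zw by (auto intro!: convex_Int)
      moreover have "bounded (snd z \<inter> snd w)"
        using int[of "fst z" "snd z"] zw by (auto intro!: bounded_Int)
      ultimately show "negligible (snd z \<inter> snd w)"
        by (simp add: negligible_convex_interior interior_Int)
    qed
  qed
  also have "\<dots> \<le> measure lebesgue U"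
    using fin U len(2) by (intro measure_mono_fmeasurable) (force intro!: fmeasurable.finite_UN[THEN fmeasurableD])+
  finally show ?thesis .
qed

text \<open>The straddle lemma: since \<open>x\<close> lies between \<open>s\<close> and
  \<open>t\<close>, the errors \<open>\<epsilon> * (t - x)\<close> and
  \<open>\<epsilon> * (x - s)\<close> of the linear approximation add up to
  \<open>\<epsilon> * (t - s)\<close>.\<close>

lemma has_real_derivative_nonpos_straddle:
  fixes f :: "real \<Rightarrow> real"
  assumes "(f has_real_derivative f') (at x within S)" "f' \<le> 0" "\<epsilon> > 0"
  shows "\<exists>r>0. \<forall>s\<in>S. \<forall>t\<in>S. s \<in> ball x r \<and> t \<in> ball x r \<and> s \<le> x \<and> x \<le> t \<longrightarrow> f t - f s \<le> \<epsilon> * (t - s)"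
proof -
  obtain r where r: "r > 0" "\<And>y. y \<in> S \<Longrightarrow> norm (y - x) < r \<Longrightarrow>
      norm (f y - f x - f' * (y - x)) \<le> \<epsilon> * norm (y - x)"
    using assms(1,3) unfolding has_field_derivative_def has_derivative_within_alt by metis
  have "f t - f s \<le> \<epsilon> * (t - s)"
    if "s \<in> S" "t \<in> S" "s \<in> ball x r" "t \<in> ball x r" "s \<le> x" "x \<le> t" for s t
  proof -
    have "\<bar>f t - f x - f' * (t - x)\<bar> \<le> \<epsilon> * (t - x)" "\<bar>f s - f x - f' * (s - x)\<bar> \<le> \<epsilon> * (x - s)"
      using r(2)[of t] r(2)[of s] that by (auto simp: dist_real_def)
    then have "f t - f x \<le> f' * (t - x) + \<epsilon> * (t - x)" "f x - f s \<le> f' * (x - s) + \<epsilon> * (x - s)"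
      by (simp_all add: abs_le_iff algebra_simps)
    moreover have "f' * (t - x) \<le> 0" "f' * (x - s) \<le> 0"
      using that assms(2) by (auto intro: mult_nonpos_nonneg)
    ultimately show ?thesis by (simp add: algebra_simps)
  qed
  with r(1) show ?thesis by blast
qed

text \<open>Each point carries a gauge: away from the null set where the derivative is bad the increments are
  small by differentiability, on the null set the intervals have small total length and absolute
  continuity applies.\<close>

lemma abs_continuous_nonincreasing:
  fixes f :: "real \<Rightarrow> real"
  assumes "a \<le> b" and ac: "abs_continuous_on_Icc a b f"
    and der: "AE t in lebesgue. t \<in> {a..b} \<longrightarrow> (\<exists>f'\<le>0. (f has_real_derivative f') (at t within {a..b}))"
  shows "f b \<le> f a"
proof (rule field_le_epsilon)
  fix \<epsilon>0 :: real assume "\<epsilon>0 > 0"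
  \<comment> \<open>The points of differentiability will cost \<open>\<epsilon> * (b - a)\<close>
    and the null set one more \<open>\<epsilon>\<close>.\<close>
  define \<epsilon> where "\<epsilon> = \<epsilon>0 / (b - a + 1)"
  have "\<epsilon> * (b - a + 1) = \<epsilon>0" using \<open>a \<le> b\<close> by (simp add: \<epsilon>_def)
  then have \<epsilon>: "\<epsilon> > 0" "\<epsilon> * (b - a) + \<epsilon> = \<epsilon>0"
    using \<open>\<epsilon>0 > 0\<close> \<open>a \<le> b\<close> by (simp_all add: \<epsilon>_def distrib_left)
  obtain N where N: "N \<in> null_sets lebesgue"
      "\<And>t. t \<in> {a..b} - N \<Longrightarrow> \<exists>f'\<le>0. (f has_real_derivative f') (at t within {a..b})"
    using der unfolding eventually_ae_filter by (elim bexE, intro that) auto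
  from ac \<epsilon>(1) obtain \<eta> where \<eta>: "\<eta> > 0" "\<And>I. finite I \<Longrightarrow>
      (\<forall>(s, t)\<in>I. a \<le> s \<and> s \<le> t \<and> t \<le> b) \<Longrightarrow>
      pairwise (\<lambda>(s, t) (s', t'). {s<..<t} \<inter> {s'<..<t'} = {}) I \<Longrightarrow>
      (\<Sum>(s, t)\<in>I. t - s) < \<eta> \<Longrightarrow> (\<Sum>(s, t)\<in>I. norm (f t - f s)) < \<epsilon>"
    unfolding abs_continuous_on_Icc_def by meson
  \<comment> \<open>Intervals with disjoint interiors inside such a \<open>U\<close> have total
    length below \<open>\<eta>\<close>, which is what absolute continuity asks for.\<close>
  obtain U where U: "open U" "N \<subseteq> U" "U - N \<in> lmeasurable" "emeasure lebesgue (U - N) < ennreal \<eta>"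
    using sets_lebesgue_outer_open[OF _ \<eta>(1)] N(1) by (metis null_setsD2)
  have U': "U \<in> lmeasurable"
  proof -
    have "(U - N) \<union> N \<in> lmeasurable" using U(3) fmeasurableI_null_sets[OF N(1)] by (rule fmeasurable.Un)
    moreover have "(U - N) \<union> N = U" using U(2) by blast
    ultimately show ?thesis by simp
  qed
  have mU: "measure lebesgue U < \<eta>"
  proof -
    have "emeasure lebesgue ((U - N) \<union> N) \<le> emeasure lebesgue (U - N) + emeasure lebesgue N"
      using U(3) N(1) by (intro emeasure_subadditive) auto
    moreover have "(U - N) \<union> N = U" using U(2) by blast
    ultimately have "emeasure lebesgue U \<le> emeasure lebesgue (U - N) + emeasure lebesgue N" by simp
    then have "emeasure lebesgue U < ennreal \<eta>" using U(4) N(1) by (simp add: null_setsD1)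
    then show ?thesis using U' \<eta>(1) by (simp add: emeasure_eq_measure2 ennreal_less_iff)
  qed
  have "\<exists>r>0. (x \<in> N \<longrightarrow> ball x r \<subseteq> U) \<and> (x \<in> {a..b} - N \<longrightarrow>
      (\<forall>s\<in>{a..b}. \<forall>t\<in>{a..b}. s \<in> ball x r \<and> t \<in> ball x r \<and> s \<le> x \<and> x \<le> t \<longrightarrow> f t - f s \<le> \<epsilon> * (t - s)))" for x
  proof (cases "x \<in> N")
    case True
    with U(1,2) obtain r where "r > 0" "ball x r \<subseteq> U" by (meson open_contains_ball subsetD)
    with True show ?thesis by blast
  next
    case False
    show ?thesis
    proof (cases "x \<in> {a..b}")
      case True
      with N(2)[of x] False obtain f' where "f' \<le> 0" "(f has_real_derivative f') (at x within {a..b})" by blast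
      from has_real_derivative_nonpos_straddle[OF this(2,1) \<epsilon>(1)] False show ?thesis by blast
    next
      case out: False
      with False show ?thesis by (intro exI[of _ 1]) auto
    qed
  qed
  then obtain r where r: "\<And>x. r x > 0" "\<And>x. x \<in> N \<Longrightarrow> ball x (r x) \<subseteq> U"
      "\<And>x s t. x \<in> {a..b} - N \<Longrightarrow> s \<in> {a..b} \<Longrightarrow> t \<in> {a..b} \<Longrightarrow> s \<in> ball x (r x) \<Longrightarrow> t \<in> ball x (r x) \<Longrightarrow>
         s \<le> x \<Longrightarrow> x \<le> t \<Longrightarrow> f t - f s \<le> \<epsilon> * (t - s)"
    by metis
  have "gauge (\<lambda>x. ball x (r x))" using r(1) by (simp add: gauge_def)
  then obtain p where p: "p tagged_division_of {a..b}" "(\<lambda>x. ball x (r x)) fine p"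
    by (rule fine_division_exists_real)
  have pp: "p tagged_partial_division_of {a..b}" using p(1) by (simp add: tagged_division_of_def)
  have fin: "finite p" using p(1) by (rule tagged_division_of_finite)
  have pD0: "K = {Inf K..Sup K} \<and> Inf K \<le> x \<and> x \<le> Sup K \<and> a \<le> Inf K \<and> Sup K \<le> b
      \<and> K \<subseteq> ball x (r x)" if xK: "(x, K) \<in> p" for x K
  proof -
    obtain c d where cd: "K = {c..d}" using tagged_division_ofD(4)[OF p(1) xK] by auto
    have x: "x \<in> K" "K \<subseteq> {a..b}" using tagged_division_ofD(2,3)[OF p(1) xK] by auto
    have "K \<subseteq> ball x (r x)" using p(2) xK by (auto simp: fine_def)
    moreover have "c \<le> d" using x(1) cd by simp
    then have "Inf K = c" "Sup K = d" "a \<le> c" "d \<le> b" using cd x by auto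
    ultimately show ?thesis using cd x(1) by (metis atLeastAtMost_iff)
  qed
  then have pK: "K = {Inf K..Sup K}" if "(x, K) \<in> p" for x K using that by blast
  have pD: "Inf K \<le> x \<and> x \<le> Sup K \<and> a \<le> Inf K \<and> Sup K \<le> b \<and> K \<subseteq> ball x (r x)"
    if "(x, K) \<in> p" for x K using pD0[OF that] by (elim conjE) (intro conjI)
  \<comment> \<open>Degenerate intervals go to \<open>p2\<close>, where their zero increment is
    harmless; in \<open>p1\<close> they would spoil the injectivity of the endpoint map.\<close>
  define p1 where "p1 = {z \<in> p. fst z \<in> N \<and> Inf (snd z) < Sup (snd z)}"
  define p2 where "p2 = {z \<in> p. fst z \<notin> N \<or> Inf (snd z) = Sup (snd z)}"
  have pD': "Inf (snd z) \<le> Sup (snd z)" if "z \<in> p" for z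
    using pD[of "fst z" "snd z"] that by auto
  have split: "p = p1 \<union> p2" "p1 \<inter> p2 = {}" "p1 \<subseteq> p" "p2 \<subseteq> p"
    using pD' by (auto simp: p1_def p2_def less_le)
  have fin12: "finite p1" "finite p2" using fin split by (auto intro: finite_subset)
  let ?g = "\<lambda>z. f (Sup (snd z)) - f (Inf (snd z))"
  have "sum ?g p2 \<le> (\<Sum>z\<in>p2. \<epsilon> * (Sup (snd z) - Inf (snd z)))"
  proof (rule sum_mono)
    fix z assume "z \<in> p2"
    then have z: "(fst z, snd z) \<in> p" "fst z \<notin> N \<or> Inf (snd z) = Sup (snd z)" by (auto simp: p2_def)
    note D = pD[OF z(1)]
    show "?g z \<le> \<epsilon> * (Sup (snd z) - Inf (snd z))"
    proof (cases "Inf (snd z) = Sup (snd z)")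
      case False
      have "Inf (snd z) \<in> {Inf (snd z)..Sup (snd z)}" "Sup (snd z) \<in> {Inf (snd z)..Sup (snd z)}"
        using pD'[of z] z by auto
      then have "Inf (snd z) \<in> snd z" "Sup (snd z) \<in> snd z" using pK[OF z(1)] by blast+
      then show ?thesis using D False z(2) by (intro r(3)[of "fst z"]) auto
    qed simp
  qed
  also have "\<dots> \<le> (\<Sum>z\<in>p. \<epsilon> * (Sup (snd z) - Inf (snd z)))"
    using split(4) fin \<epsilon>(1) pD' by (intro sum_mono2 mult_nonneg_nonneg) auto
  \<comment> \<open>Telescoping over the division, applied to the identity function.\<close>
  also have "\<dots> = \<epsilon> * (b - a)"
    using additive_tagged_division_1[OF \<open>a \<le> b\<close> p(1), of id]
    by (simp add: case_prod_unfold sum_distrib_left[symmetric])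
  finally have s2: "sum ?g p2 \<le> \<epsilon> * (b - a)" .
  \<comment> \<open>Absolute continuity speaks of a set of endpoint pairs, so distinct members of
    \<open>p1\<close> must have distinct endpoints. Equal endpoints would give equal nonempty
    interiors, which are disjoint in a division.\<close>
  have inj: "inj_on (\<lambda>z. (Inf (snd z), Sup (snd z))) p1"
    and disj: "pairwise (\<lambda>z w. {Inf (snd z)<..<Sup (snd z)} \<inter> {Inf (snd w)<..<Sup (snd w)} = {}) p1"
  proof -
    have *: "{Inf (snd z)<..<Sup (snd z)} \<inter> {Inf (snd w)<..<Sup (snd w)} = {}"
      if "z \<in> p1" "w \<in> p1" "z \<noteq> w" for z w
    proof -
      have zw: "(fst z, snd z) \<in> p" "(fst w, snd w) \<in> p" using that by (auto simp: p1_def)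
      have "interior (snd z) \<inter> interior (snd w) = {}"
        using tagged_partial_division_ofD(5)[OF pp zw] that(3) by (simp add: prod_eq_iff)
      moreover have "interior (snd z) = {Inf (snd z)<..<Sup (snd z)}" "interior (snd w) = {Inf (snd w)<..<Sup (snd w)}"
        using pK[OF zw(1)] pK[OF zw(2)] by (metis interior_atLeastAtMost_real)+
      ultimately show ?thesis by simp
    qed
    then show "pairwise (\<lambda>z w. {Inf (snd z)<..<Sup (snd z)} \<inter> {Inf (snd w)<..<Sup (snd w)} = {}) p1"
      by (simp add: pairwise_def)
    show "inj_on (\<lambda>z. (Inf (snd z), Sup (snd z))) p1"
    proof (rule inj_onI, rule ccontr)
      fix z w assume zw: "z \<in> p1" "w \<in> p1" "(Inf (snd z), Sup (snd z)) = (Inf (snd w), Sup (snd w))" "z \<noteq> w"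
      then have "{Inf (snd z)<..<Sup (snd z)} = {}" using *[of z w] by simp
      then show False using zw(1) by (auto simp: p1_def)
    qed
  qed
  define I where "I = (\<lambda>z. (Inf (snd z), Sup (snd z))) ` p1"
  have "(\<Sum>(s, t)\<in>I. norm (f t - f s)) < \<epsilon>"
  proof (rule \<eta>(2))
    show "finite I" using fin12 by (simp add: I_def)
    show "\<forall>(s, t)\<in>I. a \<le> s \<and> s \<le> t \<and> t \<le> b"
    proof -
      have "a \<le> Inf (snd z) \<and> Inf (snd z) \<le> Sup (snd z) \<and> Sup (snd z) \<le> b" if "z \<in> p1" for z
        using pD[of "fst z" "snd z"] that by (auto simp: p1_def)
      then show ?thesis by (auto simp: I_def)
    qed
    show "pairwise (\<lambda>(s, t) (s', t'). {s<..<t} \<inter> {s'<..<t'} = {}) I"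
      using disj by (force simp: I_def pairwise_def)
    have "(\<Sum>(s, t)\<in>I. t - s) = (\<Sum>(x, K)\<in>p1. Sup K - Inf K)"
      unfolding I_def using inj by (subst sum.reindex) (auto simp: case_prod_unfold)
    also have "\<dots> \<le> measure lebesgue U"
    proof (rule tagged_partial_division_length_le_measure)
      show "p1 tagged_partial_division_of {a..b}" using pp split(3) by (rule tagged_partial_division_subset)
      show "K \<subseteq> U" if "(x, K) \<in> p1" for x K
      proof -
        have "(x, K) \<in> p" "x \<in> N" using that by (auto simp: p1_def)
        with pD[of x K] r(2)[of x] show ?thesis by blast
      qed
    qed (auto simp: p1_def U')
    finally show "(\<Sum>(s, t)\<in>I. t - s) < \<eta>" using mU by simp
  qed
  moreover have "(\<Sum>(s, t)\<in>I. norm (f t - f s)) = (\<Sum>z\<in>p1. norm (?g z))"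
    unfolding I_def using inj by (subst sum.reindex) (auto simp: case_prod_unfold)
  moreover have "sum ?g p1 \<le> (\<Sum>z\<in>p1. norm (?g z))" by (intro sum_mono) simp
  ultimately have "sum ?g p1 \<le> \<epsilon>" by linarith
  moreover have "f b - f a = sum ?g p1 + sum ?g p2"
    using additive_tagged_division_1[OF \<open>a \<le> b\<close> p(1), of f] split fin12
    by (simp add: case_prod_unfold sum.union_disjoint)
  ultimately show "f b \<le> f a + \<epsilon>0" using s2 \<epsilon>(2) by linarith
qed

section \<open>Continuity, increments and norms of absolutely continuous functions\<close>

lemma abs_continuous_on_Icc_imp_continuous_on:
  fixes x :: "real \<Rightarrow> 'a::real_normed_vector"
  assumes "abs_continuous_on_Icc a b x"
  shows "continuous_on {a..b} x"
proof (rule continuous_on_iff[THEN iffD2], intro ballI allI impI)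
  fix s \<epsilon> :: real assume s: "s \<in> {a..b}" and "\<epsilon> > 0"
  with assms obtain \<eta> where \<eta>: "\<eta> > 0" "\<And>I. finite I \<Longrightarrow>
      (\<forall>(s, t)\<in>I. a \<le> s \<and> s \<le> t \<and> t \<le> b) \<Longrightarrow>
      pairwise (\<lambda>(s, t) (s', t'). {s<..<t} \<inter> {s'<..<t'} = {}) I \<Longrightarrow>
      (\<Sum>(s, t)\<in>I. t - s) < \<eta> \<Longrightarrow> (\<Sum>(s, t)\<in>I. norm (x t - x s)) < \<epsilon>"
    unfolding abs_continuous_on_Icc_def by meson
  \<comment> \<open>The family consists of the single interval between \<open>s\<close> and
    \<open>t\<close>, whichever comes first.\<close>
  have "dist (x t) (x s) < \<epsilon>" if "t \<in> {a..b}" "dist t s < \<eta>" for t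
    using \<eta>(2)[of "{(min s t, max s t)}"] s that
    by (cases "s \<le> t") (auto simp: dist_norm norm_minus_commute)
  with \<eta>(1) show "\<exists>d>0. \<forall>t\<in>{a..b}. dist t s < d \<longrightarrow> dist (x t) (x s) < \<epsilon>" by blast
qed

text \<open>Subtracting the linear function of slope \<open>c\<close> reduces this to the
  nonincreasing case.\<close>

lemma abs_continuous_increment_le:
  fixes f :: "real \<Rightarrow> real"
  assumes "a \<le> b" and ac: "abs_continuous_on_Icc a b f"
    and der: "AE t in lebesgue. t \<in> {a..b} \<longrightarrow> (\<exists>f'\<le>c. (f has_real_derivative f') (at t within {a..b}))"
  shows "f b - f a \<le> c * (b - a)"
proof -
  have "f b - c * b \<le> f a - c * a"
  proof (rule abs_continuous_nonincreasing[OF \<open>a \<le> b\<close>])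
    show "abs_continuous_on_Icc a b (\<lambda>t. f t - c * t)"
    proof (rule abs_continuous_on_Icc_dominated[OF ac, of _ "1 + \<bar>c\<bar>"])
      fix s t assume "a \<le> s" "s \<le> t" "t \<le> b"
      have "norm (f t - c * t - (f s - c * s)) = norm ((f t - f s) - c * (t - s))" by (simp add: algebra_simps)
      also have "\<dots> \<le> norm (f t - f s) + norm (c * (t - s))" by (rule norm_triangle_ineq4)
      also have "\<dots> = norm (f t - f s) + \<bar>c\<bar> * (t - s)" using \<open>s \<le> t\<close> by (simp add: abs_mult)
      also have "\<dots> \<le> (1 + \<bar>c\<bar>) * (norm (f t - f s) + (t - s))"
        using \<open>s \<le> t\<close> by (simp add: algebra_simps add_increasing2)
      finally show "norm (f t - c * t - (f s - c * s)) \<le> (1 + \<bar>c\<bar>) * (norm (f t - f s) + (t - s))" .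
    qed
    show "AE t in lebesgue. t \<in> {a..b} \<longrightarrow>
        (\<exists>f'\<le>0. ((\<lambda>t. f t - c * t) has_real_derivative f') (at t within {a..b}))"
      using der
    proof (rule AE_mp, intro AE_I2 impI)
      fix t assume "t \<in> {a..b} \<longrightarrow> (\<exists>f'\<le>c. (f has_real_derivative f') (at t within {a..b}))" "t \<in> {a..b}"
      then obtain f' where f': "f' \<le> c" "(f has_real_derivative f') (at t within {a..b})" by blast
      have "((\<lambda>t. f t - c * t) has_real_derivative f' - c) (at t within {a..b})"
        using f'(2) by (auto intro!: derivative_eq_intros)
      with f'(1) show "\<exists>f'\<le>0. ((\<lambda>t. f t - c * t) has_real_derivative f') (at t within {a..b})"
        by (intro exI[of _ "f' - c"]) simp
    qed
  qed
  then show ?thesis by (simp add: algebra_simps)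
qed

text \<open>The difference of two squares factors into
  \<open>(x t + x s) \<bullet> (x t - x s)\<close>, and \<open>x\<close> is bounded on the compact
  interval.\<close>

lemma abs_continuous_inner_self:
  fixes x :: "real \<Rightarrow> 'a::real_inner"
  assumes ac: "abs_continuous_on_Icc a b x"
  shows "abs_continuous_on_Icc a b (\<lambda>t. x t \<bullet> x t)"
proof -
  have "bounded (x ` {a..b})"
    using abs_continuous_on_Icc_imp_continuous_on[OF ac] by (intro compact_imp_bounded compact_continuous_image) auto
  then obtain B where B: "\<And>t. t \<in> {a..b} \<Longrightarrow> norm (x t) \<le> B" unfolding bounded_iff by blast
  show ?thesis
  proof (rule abs_continuous_on_Icc_dominated[OF ac, of _ "2 * B"])
    fix s t assume st: "a \<le> s" "s \<le> t" "t \<le> b"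
    have n: "norm (x s) \<le> B" "norm (x t) \<le> B" using B st by auto
    have "norm (x t \<bullet> x t - x s \<bullet> x s) = norm ((x t + x s) \<bullet> (x t - x s))"
      unfolding inner_diff_right inner_add_left by (simp add: inner_commute[of "x s" "x t"])
    also have "\<dots> \<le> norm (x t + x s) * norm (x t - x s)" using Cauchy_Schwarz_ineq2 by auto
    also have "\<dots> \<le> (2 * B) * (norm (x t - x s) + (t - s))"
      using n norm_triangle_ineq[of "x t" "x s"] norm_ge_zero[of "x s"] norm_ge_zero[of "x t - x s"] st
      by (intro mult_mono) linarith+
    finally show "norm (x t \<bullet> x t - x s \<bullet> x s) \<le> (2 * B) * (norm (x t - x s) + (t - s))" .
  qed
qed

text \<open>The squared norm is differentiated, because the norm itself need not be differentiable
  where \<open>x\<close> vanishes.\<close>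

lemma abs_continuous_norm_nonincreasing:
  fixes x :: "real \<Rightarrow> 'a::real_inner"
  assumes "a \<le> b" and ac: "abs_continuous_on_Icc a b x"
    and der: "AE t in lebesgue. t \<in> {a..b} \<longrightarrow>
      (\<exists>x'. (x has_vector_derivative x') (at t within {a..b}) \<and> x t \<bullet> x' \<le> 0)"
  shows "norm (x b) \<le> norm (x a)"
proof -
  have "x b \<bullet> x b \<le> x a \<bullet> x a"
  proof (rule abs_continuous_nonincreasing[OF \<open>a \<le> b\<close> abs_continuous_inner_self[OF ac]])
    show "AE t in lebesgue. t \<in> {a..b} \<longrightarrow>
        (\<exists>f'\<le>0. ((\<lambda>t. x t \<bullet> x t) has_real_derivative f') (at t within {a..b}))"
      using der
    proof (rule AE_mp, intro AE_I2 impI)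
      fix t assume "t \<in> {a..b} \<longrightarrow>
        (\<exists>x'. (x has_vector_derivative x') (at t within {a..b}) \<and> x t \<bullet> x' \<le> 0)" "t \<in> {a..b}"
      then obtain x' where x': "(x has_vector_derivative x') (at t within {a..b})" "x t \<bullet> x' \<le> 0" by blast
      have "((\<lambda>t. x t \<bullet> x t) has_real_derivative 2 * (x t \<bullet> x')) (at t within {a..b})"
        using x'(1) unfolding has_vector_derivative_def has_field_derivative_def
        by (auto intro!: derivative_eq_intros simp: inner_commute)
      with x'(2) show "\<exists>f'\<le>0. ((\<lambda>t. x t \<bullet> x t) has_real_derivative f') (at t within {a..b})"
        by (intro exI[of _ "2 * (x t \<bullet> x')"]) simp
    qed
  qed
  then show ?thesis by (simp add: norm_le)
qed

text \<open>Testing against the fixed vector \<open>w = x b - x a\<close> makes the problem scalar: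
  \<open>w \<bullet> x t\<close> grows at rate at most \<open>norm w * M\<close>, and its total
  increment is the square of \<open>norm w\<close>.\<close>

lemma abs_continuous_norm_increment_le:
  fixes x :: "real \<Rightarrow> 'a::real_inner"
  assumes "a \<le> b" and "M \<ge> 0" and ac: "abs_continuous_on_Icc a b x"
    and der: "AE t in lebesgue. t \<in> {a..b} \<longrightarrow>
      (\<exists>x'. (x has_vector_derivative x') (at t within {a..b}) \<and> norm x' \<le> M)"
  shows "norm (x b - x a) \<le> M * (b - a)"
proof -
  define w where "w = x b - x a"
  have "w \<bullet> x b - w \<bullet> x a \<le> (norm w * M) * (b - a)"
  proof (rule abs_continuous_increment_le[OF \<open>a \<le> b\<close>])
    show "abs_continuous_on_Icc a b (\<lambda>t. w \<bullet> x t)"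
    proof (rule abs_continuous_on_Icc_dominated[OF ac, of _ "norm w"])
      fix s t assume st: "a \<le> s" "s \<le> t" "t \<le> b"
      have "norm (w \<bullet> x t - w \<bullet> x s) \<le> norm w * norm (x t - x s)"
        using Cauchy_Schwarz_ineq2[of w "x t - x s"] by (simp add: inner_diff_right)
      also have "\<dots> \<le> norm w * (norm (x t - x s) + (t - s))" using st by (intro mult_left_mono) auto
      finally show "norm (w \<bullet> x t - w \<bullet> x s) \<le> norm w * (norm (x t - x s) + (t - s))" .
    qed
    show "AE t in lebesgue. t \<in> {a..b} \<longrightarrow>
        (\<exists>f'\<le>norm w * M. ((\<lambda>t. w \<bullet> x t) has_real_derivative f') (at t within {a..b}))"
      using der
    proof (rule AE_mp, intro AE_I2 impI)
      fix t assume "t \<in> {a..b} \<longrightarrow>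
        (\<exists>x'. (x has_vector_derivative x') (at t within {a..b}) \<and> norm x' \<le> M)" "t \<in> {a..b}"
      then obtain x' where x': "(x has_vector_derivative x') (at t within {a..b})" "norm x' \<le> M" by blast
      have "((\<lambda>t. w \<bullet> x t) has_real_derivative w \<bullet> x') (at t within {a..b})"
        using x'(1) unfolding has_vector_derivative_def has_field_derivative_def
        by (auto intro!: derivative_eq_intros simp: mult.commute)
      moreover have "w \<bullet> x' \<le> norm w * M"
        using norm_cauchy_schwarz[of w x'] x'(2) by (meson mult_left_mono norm_ge_zero order_trans)
      ultimately show "\<exists>f'\<le>norm w * M. ((\<lambda>t. w \<bullet> x t) has_real_derivative f') (at t within {a..b})" by blast
    qed
  qed
  then have "norm w * norm w \<le> norm w * (M * (b - a))"
    by (simp add: w_def inner_diff_right[symmetric] power2_norm_eq_inner[symmetric] power2_eq_square mult_ac)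
  moreover have "M * (b - a) \<ge> 0" using \<open>a \<le> b\<close> \<open>M \<ge> 0\<close> by simp
  ultimately show ?thesis unfolding w_def[symmetric]
    by (cases "norm w = 0") (auto simp: w_def[symmetric])
qed

text \<open>A Barbalat-type argument. If \<open>norm (y t)\<close> reached \<open>\<epsilon>\<close>
  at a late time, the Lipschitz bound would keep it above \<open>\<epsilon> / 2\<close> for a fixed
  duration \<open>h\<close>, and \<open>G\<close> would grow by a fixed amount
  \<open>\<rho>\<close>, contradicting its convergence.\<close>

lemma tendsto_zero_of_dissipation:
  fixes y :: "real \<Rightarrow> 'a::real_normed_vector" and G :: "real \<Rightarrow> real"
  assumes lip: "\<And>s t. 0 \<le> s \<Longrightarrow> s \<le> t \<Longrightarrow> norm (y t - y s) \<le> L * (t - s)"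
    and G: "(G \<longlongrightarrow> g) at_top"
    and inc: "\<And>a b \<mu>. 0 \<le> a \<Longrightarrow> a \<le> b \<Longrightarrow> (\<And>t. t \<in> {a..b} \<Longrightarrow> \<mu> \<le> norm (y t)) \<Longrightarrow> c * \<mu> * (b - a) \<le> G b - G a"
    and "c > 0"
  shows "(y \<longlongrightarrow> 0) at_top"
proof (rule tendstoI)
  fix \<epsilon> :: real assume "\<epsilon> > 0"
  define D where "D = \<bar>L\<bar> + 1"
  have D: "D > 0" "L \<le> D" by (auto simp: D_def)
  \<comment> \<open>Within this time \<open>y\<close> moves by at most
    \<open>\<epsilon> / 2\<close>.\<close>
  define h where "h = \<epsilon> / (2 * D)"
  have h: "h > 0" using \<open>\<epsilon> > 0\<close> D by (simp add: h_def)
  have Lh: "L * h \<le> \<epsilon> / 2"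
  proof -
    have "L * h \<le> D * h" using h D by (intro mult_right_mono) auto
    also have "\<dots> = \<epsilon> / 2" using D by (simp add: h_def)
    finally show ?thesis .
  qed
  define \<rho> where "\<rho> = c * (\<epsilon> / 2) * h"
  have "\<rho> > 0" using h \<open>\<epsilon> > 0\<close> \<open>c > 0\<close> by (simp add: \<rho>_def)
  then have "eventually (\<lambda>t. dist (G t) g < \<rho> / 2) at_top" using G by (intro tendstoD) auto
  then obtain T where T: "\<And>t. t \<ge> T \<Longrightarrow> dist (G t) g < \<rho> / 2" by (auto simp: eventually_at_top_linorder)
  have "norm (y t) < \<epsilon>" if t: "t \<ge> max 0 T" for t
  proof (rule ccontr)
    assume "\<not> norm (y t) < \<epsilon>"
    have "\<epsilon> / 2 \<le> norm (y s)" if s: "s \<in> {t..t + h}" for s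
    proof -
      have "norm (y s - y t) \<le> L * (s - t)" using s t by (intro lip) auto
      also have "\<dots> \<le> \<epsilon> / 2"
      proof (cases "L \<ge> 0")
        case True
        then have "L * (s - t) \<le> L * h" using s by (intro mult_left_mono) auto
        with Lh show ?thesis by simp
      next
        case False
        then have "L * (s - t) \<le> 0" using s by (intro mult_nonpos_nonneg) auto
        with \<open>\<epsilon> > 0\<close> show ?thesis by simp
      qed
      finally show ?thesis using \<open>\<not> norm (y t) < \<epsilon>\<close> norm_triangle_ineq2[of "y t" "y s"]
        by (simp add: norm_minus_commute)
    qed
    from inc[of t "t + h", OF _ _ this] t h have "\<rho> \<le> G (t + h) - G t" by (simp add: \<rho>_def)
    moreover have "dist (G t) g < \<rho> / 2" "dist (G (t + h)) g < \<rho> / 2" using T t h by auto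
    ultimately show False unfolding dist_real_def by linarith
  qed
  then show "eventually (\<lambda>t. dist (y t) 0 < \<epsilon>) at_top"
    by (auto simp: eventually_at_top_linorder intro!: exI[of _ "max 0 T"])
qed

text \<open>While \<open>y\<close> is nonzero its norm decreases at rate at least \<open>c\<close>,
  so a zero occurs; after it the monotonicity of the norm keeps \<open>y\<close> at zero.\<close>

lemma finite_time_convergence:
  fixes y :: "real \<Rightarrow> 'a::real_inner"
  assumes ac: "\<And>b. abs_continuous_on_Icc T b y" and "c > 0"
    and der: "AE t in lebesgue. t \<ge> T \<longrightarrow>
      (\<exists>y'. (y has_vector_derivative y') (at t within {T..}) \<and> y t \<bullet> y' \<le> - c * norm (y t))"
  shows "\<exists>T'\<ge>T. \<forall>t\<ge>T'. y t = 0"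
proof -
  have mono: "norm (y b) \<le> norm (y a)" if "T \<le> a" "a \<le> b" for a b
  proof (rule abs_continuous_norm_nonincreasing[OF \<open>a \<le> b\<close>])
    show "abs_continuous_on_Icc a b y" using ac[of b] \<open>T \<le> a\<close> by (rule abs_continuous_on_Icc_subinterval) simp
    show "AE t in lebesgue. t \<in> {a..b} \<longrightarrow>
        (\<exists>x'. (y has_vector_derivative x') (at t within {a..b}) \<and> y t \<bullet> x' \<le> 0)"
      using der
    proof (rule AE_mp, intro AE_I2 impI)
      fix t assume *: "t \<ge> T \<longrightarrow>
        (\<exists>y'. (y has_vector_derivative y') (at t within {T..}) \<and> y t \<bullet> y' \<le> - c * norm (y t))" "t \<in> {a..b}"
      then obtain y' where y': "(y has_vector_derivative y') (at t within {T..})" "y t \<bullet> y' \<le> - c * norm (y t)"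
        using \<open>T \<le> a\<close> by auto
      have "(y has_vector_derivative y') (at t within {a..b})"
        using y'(1) \<open>T \<le> a\<close> by (auto intro: has_vector_derivative_within_subset)
      moreover have "- c * norm (y t) \<le> 0" using \<open>c > 0\<close> by simp
      ultimately show "\<exists>x'. (y has_vector_derivative x') (at t within {a..b}) \<and> y t \<bullet> x' \<le> 0"
        using y'(2) order_trans by blast
    qed
  qed
  \<comment> \<open>The time in which a decrease at rate \<open>c\<close> uses up
    \<open>norm (y T)\<close>, prolonged by one so that the norm would become negative.\<close>
  define b where "b = T + norm (y T) / c + 1"
  have "T \<le> b" using \<open>c > 0\<close> by (simp add: b_def add_increasing2)
  have "\<exists>t\<in>{T..b}. y t = 0"
  proof (rule ccontr)
    assume "\<not> ?thesis"
    then have nz: "y t \<noteq> 0" if "t \<in> {T..b}" for t using that by blast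
    have "norm (y b) - norm (y T) \<le> - c * (b - T)"
    proof (rule abs_continuous_increment_le[OF \<open>T \<le> b\<close>])
      show "abs_continuous_on_Icc T b (\<lambda>t. norm (y t))"
      proof (rule abs_continuous_on_Icc_dominated[OF ac, of _ _ 1])
        show "norm (norm (y t) - norm (y s)) \<le> 1 * (norm (y t - y s) + (t - s))" if "s \<le> t" for s t
          using norm_triangle_ineq3[of "y t" "y s"] that by simp
      qed
      show "AE t in lebesgue. t \<in> {T..b} \<longrightarrow>
          (\<exists>f'\<le>-c. ((\<lambda>t. norm (y t)) has_real_derivative f') (at t within {T..b}))"
        using der
      proof (rule AE_mp, intro AE_I2 impI)
        fix t assume *: "t \<ge> T \<longrightarrow>
          (\<exists>y'. (y has_vector_derivative y') (at t within {T..}) \<and> y t \<bullet> y' \<le> - c * norm (y t))" "t \<in> {T..b}"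
        then obtain y' where y': "(y has_vector_derivative y') (at t within {T..})" "y t \<bullet> y' \<le> - c * norm (y t)"
          by auto
        have d: "(y has_derivative (\<lambda>h. h *\<^sub>R y')) (at t within {T..b})"
          using y'(1) unfolding has_vector_derivative_def by (auto intro: has_derivative_subset)
        \<comment> \<open>On vectors \<open>sgn\<close> is normalisation, the gradient of the norm
          away from zero.\<close>
        have "((\<lambda>t. norm (y t)) has_derivative (\<lambda>h. (h *\<^sub>R y') \<bullet> sgn (y t))) (at t within {T..b})"
          using has_derivative_compose[OF d has_derivative_norm[OF nz[OF *(2)]]] by simp
        then have "((\<lambda>t. norm (y t)) has_real_derivative y' \<bullet> sgn (y t)) (at t within {T..b})"
          by (simp add: has_field_derivative_def mult.commute[of _ "y' \<bullet> sgn (y t)"])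
        moreover have "y' \<bullet> sgn (y t) \<le> - c"
          using y'(2) nz[OF *(2)] by (simp add: sgn_div_norm inner_commute divide_simps mult_ac)
        ultimately show "\<exists>f'\<le>-c. ((\<lambda>t. norm (y t)) has_real_derivative f') (at t within {T..b})" by blast
      qed
    qed
    also have "\<dots> = - norm (y T) - c" using \<open>c > 0\<close> by (simp add: b_def field_simps)
    finally have "norm (y b) \<le> - c" by simp
    with \<open>c > 0\<close> show False using norm_ge_zero[of "y b"] by linarith
  qed
  then obtain T' where T': "T' \<ge> T" "y T' = 0" by auto
  with mono[of T'] show ?thesis by (intro exI[of _ T']) auto
qed

section \<open>Filippov set-valued maps\<close>

text \<open>The member of the intersection for radius \<open>\<epsilon>\<close> and the empty
  exceptional set already lies in \<open>C\<close>.\<close>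

lemma filippov_map_closed_convex:
  assumes "x' \<in> filippov_map F t x" "\<epsilon> > 0" "closed C" "convex C" "F t ` ball x \<epsilon> \<subseteq> C"
  shows "x' \<in> C"
proof -
  have "x' \<in> closure (convex hull (F t ` (ball x \<epsilon> - {})))"
    using assms(1,2) unfolding filippov_map_def by blast
  also have "\<dots> \<subseteq> C" using assms(3-5) by (intro closure_minimal hull_minimal) auto
  finally show ?thesis .
qed

text \<open>Near \<open>x\<close> all values of \<open>F t\<close> lie in a thin slab orthogonal to
  \<open>w\<close>, which is closed and convex, so the slab contains \<open>x'\<close> as well. A
  direction in which the jumps of \<open>F\<close> are invisible thus turns the inclusion into an
  equation.\<close>

lemma filippov_map_inner_eq:
  assumes x': "x' \<in> filippov_map F t x" and cont: "isCont (\<lambda>y. w \<bullet> F t y) x"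
  shows "w \<bullet> x' = w \<bullet> F t x"
proof -
  have "\<bar>w \<bullet> x' - w \<bullet> F t x\<bar> \<le> \<eta>" if \<eta>: "\<eta> > 0" for \<eta>
  proof -
    obtain \<epsilon> where \<epsilon>: "\<epsilon> > 0" "\<And>y. dist y x < \<epsilon> \<Longrightarrow> dist (w \<bullet> F t y) (w \<bullet> F t x) < \<eta>"
      using cont \<eta> unfolding continuous_at_eps_delta by blast
    have "x' \<in> {z. w \<bullet> z \<le> w \<bullet> F t x + \<eta>} \<inter> {z. w \<bullet> z \<ge> w \<bullet> F t x - \<eta>}"
    proof (rule filippov_map_closed_convex[OF x' \<epsilon>(1)])
      show "F t ` ball x \<epsilon> \<subseteq> {z. w \<bullet> z \<le> w \<bullet> F t x + \<eta>} \<inter> {z. w \<bullet> z \<ge> w \<bullet> F t x - \<eta>}"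
      proof (rule image_subsetI)
        fix y assume "y \<in> ball x \<epsilon>"
        then have "\<bar>w \<bullet> F t y - w \<bullet> F t x\<bar> < \<eta>" using \<epsilon>(2)[of y] by (simp add: dist_commute dist_real_def)
        then show "F t y \<in> {z. w \<bullet> z \<le> w \<bullet> F t x + \<eta>} \<inter> {z. w \<bullet> z \<ge> w \<bullet> F t x - \<eta>}" by auto
      qed
    qed (intro closed_Int convex_Int closed_halfspace_le closed_halfspace_ge convex_halfspace_le convex_halfspace_ge)+
    then show ?thesis by auto
  qed
  then have "\<bar>w \<bullet> x' - w \<bullet> F t x\<bar> \<le> 0" by (intro field_le_epsilon[of _ 0]) simp
  then show ?thesis by simp
qed

section \<open>The bearing Laplacian\<close>

text \<open>The null space is the orthogonal complement of the row space.\<close>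

lemma rank_plus_dim_null_space:
  fixes A :: "real^'n^'m"
  shows "rank A + dim {x. A *v x = 0} = CARD('n)"
proof -
  have "rows A = range (vec_nth A)" by (auto simp: rows_def row_def)
  then have "{x. A *v x = 0} = {y \<in> UNIV. \<forall>x\<in>rows A. orthogonal x y}"
    by (auto simp: orthogonal_def vec_eq_iff matrix_vector_mul_component)
  also have "\<dots> = {y \<in> UNIV. \<forall>x\<in>span (rows A). orthogonal x y}"
  proof (intro Collect_cong conj_cong refl iffI ballI)
    fix x y assume "\<forall>x\<in>rows A. orthogonal x y" "x \<in> span (rows A)"
    then show "orthogonal x y" using orthogonal_to_span[of x "rows A" y] orthogonal_commute by blast
  qed (auto intro: span_base)
  finally have "dim {x. A *v x = 0} + dim (span (rows A)) = DIM(real^'n)"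
    using dim_subspace_orthogonal_to_vectors[of "span (rows A)" "UNIV :: (real^'n) set"] by simp
  then show ?thesis by (simp add: row_rank_def)
qed

section \<open>Symmetric matrices and the smallest eigenvalue\<close>

lemma inner_matrix_symmetric:
  fixes A :: "real^'n^'n"
  assumes "transpose A = A"
  shows "x \<bullet> (A *v y) = (A *v x) \<bullet> y"
  using dot_lmul_matrix[of x A y] assms by (metis vector_transpose_matrix)

lemma inner_transpose_mult_self:
  fixes A :: "real^'n^'m"
  shows "x \<bullet> ((transpose A ** A) *v x) = (A *v x) \<bullet> (A *v x)"
  by (metis dot_lmul_matrix matrix_vector_mul_assoc transpose_transpose vector_transpose_matrix)

text \<open>The quadratic form attains its minimum on the compact unit sphere. At a minimiser
  \<open>x0\<close> the residual \<open>r\<close> of the eigenvalue equation must vanish, since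
  otherwise a small move along \<open>- r\<close> would lower the Rayleigh quotient.\<close>

lemma minimal_eigenvalue_exists:
  fixes A :: "real^'n^'n"
  assumes sym: "transpose A = A"
  obtains \<mu> where "is_eigenvalue A \<mu>" "\<And>x. \<mu> * (x \<bullet> x) \<le> x \<bullet> (A *v x)"
proof -
  have "compact (sphere (0::real^'n) 1)" by simp
  moreover have "sphere (0::real^'n) 1 \<noteq> {}" by (simp add: sphere_eq_empty)
  moreover have "continuous_on (sphere (0::real^'n) 1) (\<lambda>x. x \<bullet> (A *v x))"
    by (intro continuous_intros linear_continuous_on) (auto simp: matrix_vector_mul_bounded_linear)
  ultimately obtain x0 where x0: "norm x0 = 1"
      "\<And>x. norm x = 1 \<Longrightarrow> x0 \<bullet> (A *v x0) \<le> x \<bullet> (A *v x)"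
    using continuous_attains_inf[of "sphere 0 1" "\<lambda>x. x \<bullet> (A *v x)"] by auto
  define \<mu> where "\<mu> = x0 \<bullet> (A *v x0)"
  have min: "\<mu> * (x \<bullet> x) \<le> x \<bullet> (A *v x)" for x
  proof (cases "x = 0")
    case False
    have "\<mu> \<le> (x /\<^sub>R norm x) \<bullet> (A *v (x /\<^sub>R norm x))"
      unfolding \<mu>_def using False by (intro x0(2)) simp
    also have "\<dots> = (x \<bullet> (A *v x)) / (x \<bullet> x)"
      by (simp add: matrix_vector_mult_scaleR dot_square_norm power2_eq_square divide_simps)
    finally show ?thesis using False by (simp add: pos_le_divide_eq)
  qed simp
  define r where "r = A *v x0 - \<mu> *\<^sub>R x0"
  define F where "F = r \<bullet> (A *v r) - \<mu> * (r \<bullet> r)"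
  have F: "F \<ge> 0" using min[of r] by (simp add: F_def)
  \<comment> \<open>The nonnegative form
    \<open>x \<bullet> (A *v x) - \<mu> * (x \<bullet> x)\<close> evaluated at
    \<open>x0 - s r\<close>; it is zero at \<open>x0\<close>.\<close>
  have pert: "0 \<le> s\<^sup>2 * F - 2 * s * (r \<bullet> r)" for s
  proof -
    have "(x0 - s *\<^sub>R r) \<bullet> (A *v (x0 - s *\<^sub>R r)) - \<mu> * ((x0 - s *\<^sub>R r) \<bullet> (x0 - s *\<^sub>R r)) =
        (x0 \<bullet> (A *v x0) - \<mu> * (x0 \<bullet> x0)) - 2 * s * (r \<bullet> (A *v x0 - \<mu> *\<^sub>R x0)) + s\<^sup>2 * F"
    proof -
      have "x0 \<bullet> (A *v r) = r \<bullet> (A *v x0)"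
        using inner_matrix_symmetric[OF sym, of x0 r] by (simp add: inner_commute[of r])
      then show ?thesis
        unfolding F_def matrix_vector_mult_diff_distrib matrix_vector_mult_scaleR inner_diff_left inner_diff_right
          inner_scaleR_left inner_scaleR_right inner_commute[of x0 r] power2_eq_square
        by (simp add: algebra_simps)
    qed
    also have "\<dots> = s\<^sup>2 * F - 2 * s * (r \<bullet> r)"
    proof -
      have "x0 \<bullet> x0 = 1" using x0(1) by (simp add: dot_square_norm)
      then show ?thesis unfolding r_def[symmetric] by (simp add: \<mu>_def)
    qed
    finally show ?thesis using min[of "x0 - s *\<^sub>R r"] by simp
  qed
  have "r \<bullet> r = 0"
  proof (rule ccontr)
    assume "r \<bullet> r \<noteq> 0"
    then have rr: "r \<bullet> r > 0" using inner_ge_zero[of r] by linarith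
    \<comment> \<open>With this \<open>s\<close> the product \<open>s * F\<close> stays below
      \<open>r \<bullet> r\<close>, so the linear term outweighs the quadratic one.\<close>
    define s where "s = (r \<bullet> r) / (F + 1)"
    have s: "s > 0" using rr F by (simp add: s_def)
    have "s * (s * F - 2 * (r \<bullet> r)) \<ge> 0" using pert[of s] by (simp add: power2_eq_square algebra_simps)
    then have "s * F - 2 * (r \<bullet> r) \<ge> 0" using s by (simp add: zero_le_mult_iff)
    moreover have "s * (F + 1) = r \<bullet> r" using F by (simp add: s_def)
    then have "s * F + s = r \<bullet> r" by (simp add: algebra_simps)
    ultimately show False using s rr by linarith
  qed
  then have "A *v x0 = \<mu> *\<^sub>R x0" by (simp add: r_def)
  moreover have "x0 \<noteq> 0" using x0(1) by auto
  ultimately have "is_eigenvalue A \<mu>" unfolding is_eigenvalue_def by blast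
  from this min show ?thesis by (rule that)
qed

text \<open>The \<open>LEAST\<close> in \<open>lambda_min\<close> is attained here: the minimum of
  the Rayleigh quotient is an eigenvalue and lies below all others.\<close>

lemma lambda_min_symmetric:
  fixes A :: "real^'n^'n"
  assumes sym: "transpose A = A"
  shows "is_eigenvalue A (lambda_min A)" "lambda_min A * (x \<bullet> x) \<le> x \<bullet> (A *v x)"
proof -
  obtain \<mu> where \<mu>: "is_eigenvalue A \<mu>" "\<And>x. \<mu> * (x \<bullet> x) \<le> x \<bullet> (A *v x)"
    using minimal_eigenvalue_exists[OF sym] by blast
  have "\<mu> \<le> \<nu>" if \<nu>: "is_eigenvalue A \<nu>" for \<nu>
  proof -
    obtain y where y: "y \<noteq> 0" "A *v y = \<nu> *\<^sub>R y" using \<nu> by (auto simp: is_eigenvalue_def)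
    then have "y \<bullet> y > 0" by simp
    with \<mu>(2)[of y] y show ?thesis by simp
  qed
  then have "lambda_min A = \<mu>" unfolding lambda_min_def using \<mu>(1) by (intro Least_equality)
  with \<mu> show "is_eigenvalue A (lambda_min A)" "lambda_min A * (x \<bullet> x) \<le> x \<bullet> (A *v x)" by auto
qed

lemma lambda_min_pos:
  fixes A :: "real^'n^'n"
  assumes "transpose A = A" "\<And>x. x \<noteq> 0 \<Longrightarrow> 0 < x \<bullet> (A *v x)"
  shows "0 < lambda_min A"
proof -
  obtain y where y: "y \<noteq> 0" "A *v y = lambda_min A *\<^sub>R y"
    using lambda_min_symmetric(1)[OF assms(1)] unfolding is_eigenvalue_def by blast
  have "0 < lambda_min A * (y \<bullet> y)" using assms(2)[OF y(1)] unfolding y(2) by simp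
  moreover have "0 < y \<bullet> y" using y(1) by simp
  ultimately show ?thesis by (rule zero_less_mult_pos2)
qed

section \<open>Stacked vectors, block matrices and the rigidity matrix\<close>

definition flatten :: "real^'d^'n \<Rightarrow> real^('n \<times> 'd)" where
  "flatten x = (\<chi> r. x $ fst r $ snd r)"

lemma flatten_eq_iff [simp]: "flatten x = flatten y \<longleftrightarrow> x = y"
  by (auto simp: flatten_def vec_eq_iff)

lemma flatten_0 [simp]: "flatten 0 = 0"
  by (simp add: flatten_def vec_eq_iff)

lemma surj_flatten: obtains y where "x = flatten y"
proof
  show "x = flatten (\<chi> i a. x $ (i, a))" by (simp add: flatten_def vec_eq_iff)
qed

lemma inner_flatten [simp]: "flatten x \<bullet> flatten y = x \<bullet> (y :: real^'d::finite^'n::finite)"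
  by (simp add: inner_vec_def flatten_def UNIV_Times_UNIV[symmetric] sum.cartesian_product' del: UNIV_Times_UNIV)

lemma matrix_mult_flatten:
  "(A *v flatten x) $ r = (\<Sum>i\<in>UNIV. \<Sum>a\<in>UNIV. A $ r $ (i, a) * x $ i $ a)"
  for x :: "real^'d::finite^'n::finite"
  by (simp add: matrix_vector_mult_def flatten_def UNIV_Times_UNIV[symmetric] sum.cartesian_product' del: UNIV_Times_UNIV)

lemma blkdiag_mult_flatten: "blkdiag P *v flatten y = flatten (\<chi> k. P k *v y $ k)"
proof -
  have "(blkdiag P *v flatten y) $ r = flatten (\<chi> k. P k *v y $ k) $ r" for r
  proof -
    have "(blkdiag P *v flatten y) $ r =
        (\<Sum>i\<in>UNIV. if fst r = i then \<Sum>a\<in>UNIV. P i $ snd r $ a * y $ i $ a else 0)"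
      unfolding matrix_mult_flatten by (intro sum.cong) (auto simp: blkdiag_def)
    then show ?thesis by (simp add: flatten_def matrix_vector_mult_def)
  qed
  then show ?thesis unfolding vec_eq_iff by blast
qed

lemma kronecker_mat_1_mult_flatten:
  "kronecker A (mat 1) *v flatten x = flatten (\<chi> k. \<Sum>i\<in>UNIV. A $ k $ i *\<^sub>R x $ i)"
proof -
  have "(\<Sum>a\<in>UNIV. A $ k $ i * (if b = a then 1 else 0) * x $ i $ a) = A $ k $ i * x $ i $ b" for k i b
  proof -
    have "(\<Sum>a\<in>UNIV. A $ k $ i * (if b = a then 1 else 0) * x $ i $ a) =
        (\<Sum>a\<in>UNIV. if b = a then A $ k $ i * x $ i $ a else 0)" by (intro sum.cong) auto
    then show ?thesis by simp
  qed
  then show ?thesis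
    by (simp add: vec_eq_iff matrix_mult_flatten kronecker_def mat_def) (simp add: flatten_def)
qed

lemma sum_incidence:
  fixes x :: "real^'d^'n::finite"
  assumes "fst (e k) \<noteq> snd (e k)"
  shows "(\<Sum>i\<in>UNIV. incidence e $ k $ i *\<^sub>R x $ i) = x $ snd (e k) - x $ fst (e k)"
proof -
  have "(\<Sum>i\<in>UNIV. incidence e $ k $ i *\<^sub>R x $ i) =
      (\<Sum>i\<in>UNIV. (if i = snd (e k) then x $ i else 0) - (if i = fst (e k) then x $ i else 0))"
    using assms by (intro sum.cong) (auto simp: incidence_def)
  then show ?thesis by (simp add: sum_subtractf)
qed

text \<open>The bearings come from \<open>p\<close>, the displacement from \<open>x\<close>. The
  order is start minus end, as in \<open>q_vec\<close>, whereas the incidence matrix takes end minus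
  start; hence the minus sign in \<open>rigidity_matrix_mult_flatten\<close>.\<close>

definition edge_displacement ::
  "('m \<Rightarrow> 'n \<times> 'n) \<Rightarrow> real^'d^'n \<Rightarrow> real^'d^'n \<Rightarrow> 'm \<Rightarrow> real^'d" where
  "edge_displacement e p x k =
     proj_orth (bearing p (fst (e k)) (snd (e k))) *v (x $ fst (e k) - x $ snd (e k))"

lemma rigidity_matrix_mult_flatten:
  assumes "\<And>k. fst (e k) \<noteq> snd (e k)"
  shows "rigidity_matrix e p *v flatten x = - flatten (\<chi> k. edge_displacement e p x k)"
proof -
  have "rigidity_matrix e p *v flatten x =
      flatten (\<chi> k. proj_orth (bearing p (fst (e k)) (snd (e k))) *v (x $ snd (e k) - x $ fst (e k)))"
    by (simp add: rigidity_matrix_def matrix_vector_mul_assoc[symmetric] kronecker_mat_1_mult_flatten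
        blkdiag_mult_flatten sum_incidence[of e, OF assms])
  then show ?thesis
    by (simp add: flatten_def vec_eq_iff edge_displacement_def matrix_vector_mult_diff_distrib)
qed

lemma inner_bearing_laplacian:
  assumes "\<And>k. fst (e k) \<noteq> snd (e k)"
  shows "flatten x \<bullet> (bearing_laplacian e p *v flatten x) =
    (\<Sum>k\<in>UNIV. (norm (edge_displacement e p x k))\<^sup>2)"
  by (simp add: bearing_laplacian_def inner_transpose_mult_self rigidity_matrix_mult_flatten[OF assms] power2_norm_eq_inner)
     (simp add: inner_vec_def)

lemma sum_UNIV_Plus: "(\<Sum>i\<in>(UNIV :: ('l::finite + 'f::finite) set). g i) = (\<Sum>i\<in>UNIV. g (Inl i)) + (\<Sum>i\<in>UNIV. g (Inr i))"
  by (simp add: UNIV_Plus_UNIV[symmetric] sum.Plus comp_def del: UNIV_Plus_UNIV)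

lemma configuration_nth [simp]:
  "configuration pl pf $ Inl a = pl $ Inl a" "configuration pl pf $ Inr b = pf $ b"
  by (simp_all add: configuration_def)

lemma inner_configuration_0:
  "configuration 0 y \<bullet> x = (\<Sum>i\<in>UNIV. y $ i \<bullet> x $ Inr i)"
  by (simp add: inner_vec_def sum_UNIV_Plus)

text \<open>A principal block acts as the full matrix on vectors extended by zero;
  \<open>configuration 0 y\<close> is this extension to the leaders.\<close>

lemma inner_follower_block:
  fixes y :: "real^'d::finite^'f::finite"
  shows "flatten y \<bullet> (follower_block A *v flatten y) =
    flatten (configuration 0 y) \<bullet> (A *v flatten (configuration 0 y))"
proof -
  have *: "flatten y \<bullet> w = (\<Sum>i\<in>UNIV. \<Sum>a\<in>UNIV. y $ i $ a * w $ (i, a))" for w and y :: "real^'d^'k::finite"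
    by (simp add: inner_vec_def flatten_def UNIV_Times_UNIV[symmetric] sum.cartesian_product' del: UNIV_Times_UNIV)
  show ?thesis unfolding * matrix_mult_flatten by (simp add: sum_UNIV_Plus follower_block_def)
qed

lemma transpose_follower_block_bearing_laplacian:
  "transpose (follower_block (bearing_laplacian e p)) = follower_block (bearing_laplacian e p)"
proof -
  have "transpose (bearing_laplacian e p) = bearing_laplacian e p"
    by (simp add: bearing_laplacian_def matrix_transpose_mul)
  then have "bearing_laplacian e p $ r $ c = bearing_laplacian e p $ c $ r" for r c
    by (metis (no_types) transpose_def vec_lambda_beta)
  then show ?thesis by (simp add: follower_block_def transpose_def vec_eq_iff)
qed

section \<open>Bearings, projections and the kernel under rigidity\<close>

lemma proj_orth_mult: "proj_orth g *v z = z - (g \<bullet> z) *\<^sub>R g"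
  by (simp add: proj_orth_def matrix_vector_mult_diff_rdistrib vec_eq_iff)
     (simp add: matrix_vector_mult_def inner_vec_def sum_distrib_left mult_ac)

lemma inner_proj_orth: "x \<bullet> (proj_orth g *v y) = (proj_orth g *v x) \<bullet> y"
  by (simp add: proj_orth_mult inner_diff_left inner_diff_right inner_commute)

text \<open>With \<open>proj_orth_uminus\<close> this makes the projection along an edge independent
  of its orientation.\<close>

lemma bearing_commute: "bearing p j i = - bearing p i j"
  by (simp add: bearing_def norm_minus_commute scaleR_right_diff_distrib)

lemma proj_orth_uminus [simp]: "proj_orth (- g) = proj_orth g"
  by (simp add: proj_orth_def)

lemma proj_orth_bearing_self:
  assumes "p $ i \<noteq> p $ j"
  shows "proj_orth (bearing p i j) *v (p $ j - p $ i) = 0"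
proof -
  define z where "z = p $ j - p $ i"
  have "norm z \<noteq> 0" using assms by (auto simp: z_def)
  moreover have "z \<bullet> z = norm z * norm z" by (simp add: dot_square_norm power2_eq_square)
  ultimately show ?thesis
    by (simp add: proj_orth_mult bearing_def z_def[symmetric] field_simps)
qed

lemma two_distinct_elements:
  assumes "CARD('n) \<ge> 2"
  obtains i j :: "'n::finite" where "i \<noteq> j"
proof -
  have "\<not> card (UNIV :: 'n set) \<le> Suc 0" using assms by simp
  then show ?thesis using that by (auto simp: card_le_Suc0_iff_eq)
qed

text \<open>Translations and scalings form a subspace of dimension \<open>d + 1\<close> of the null space of the rigidity matrix,
  hence all of it by the rank condition.\<close>

lemma rigid_kernel:
  fixes p :: "real^'d::finite^'n::finite"
  assumes e: "\<And>k. fst (e k) \<noteq> snd (e k)" and distinct: "\<And>i j. i \<noteq> j \<Longrightarrow> p $ i \<noteq> p $ j"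
    and rigid: "infinitesimally_bearing_rigid e p" and n: "CARD('n) \<ge> 2"
    and x: "\<And>k. edge_displacement e p x k = 0"
  obtains s c where "\<And>i. x $ i = s *\<^sub>R p $ i + c"
proof -
  let ?L = "\<lambda>(c :: real^'d, s :: real). flatten (\<chi> i. s *\<^sub>R p $ i + c)"
  let ?N = "{z. rigidity_matrix e p *v z = 0}"
  have lin: "linear ?L" by (rule linearI) (auto simp: flatten_def vec_eq_iff algebra_simps)
  have inj: "inj ?L"
  proof (rule linear_injective_0[OF lin, THEN iffD2], intro allI impI)
    fix z assume "?L z = 0"
    then have z: "snd z *\<^sub>R p $ i + fst z = 0" for i
      by (simp add: case_prod_unfold flatten_def vec_eq_iff)
    obtain i j :: 'n where "i \<noteq> j" using n by (rule two_distinct_elements)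
    \<comment> \<open>Two distinct points exclude a scaling, and then the translation vanishes
      too.\<close>
    have "snd z *\<^sub>R p $ i + fst z = snd z *\<^sub>R p $ j + fst z" using z[of i] z[of j] by simp
    then have "snd z = 0" using distinct[OF \<open>i \<noteq> j\<close>] by simp
    with z[of i] show "z = 0" by (simp add: prod_eq_iff)
  qed
  have sub: "range ?L \<subseteq> ?N"
  proof clarsimp
    fix c s
    have "edge_displacement e p (\<chi> i. s *\<^sub>R p $ i + c) k = 0" for k
    proof -
      have "edge_displacement e p (\<chi> i. s *\<^sub>R p $ i + c) k =
          (- s) *\<^sub>R (proj_orth (bearing p (fst (e k)) (snd (e k))) *v (p $ snd (e k) - p $ fst (e k)))"
        unfolding edge_displacement_def matrix_vector_mult_scaleR[symmetric]
        by (simp add: scaleR_right_diff_distrib)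
      then show ?thesis using proj_orth_bearing_self[OF distinct[OF e]] by simp
    qed
    then have "(\<chi> k. edge_displacement e p (\<chi> i. s *\<^sub>R p $ i + c) k) = 0" by (simp add: vec_eq_iff)
    then show "rigidity_matrix e p *v flatten (\<chi> i. s *\<^sub>R p $ i + c) = 0"
      by (simp add: rigidity_matrix_mult_flatten[OF e])
  qed
  have "dim (range ?L) = CARD('d) + 1"
    using dim_image_eq[OF lin, of UNIV] inj by simp
  \<comment> \<open>The rank condition is stated with truncated subtraction of natural numbers; this
    bound makes it exact.\<close>
  moreover have "CARD('d) * CARD('n) \<ge> CARD('d) + 1"
  proof -
    have "CARD('d) * 2 \<le> CARD('d) * CARD('n)" using n by (intro mult_left_mono) auto
    moreover have "CARD('d) \<ge> 1" by (simp add: Suc_leI)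
    ultimately show ?thesis by linarith
  qed
  then have "dim ?N = CARD('d) + 1"
    using rank_plus_dim_null_space[of "rigidity_matrix e p"] rigid
    by (simp add: infinitesimally_bearing_rigid_def mult.commute)
  moreover have "subspace ?N"
    using linear_subspace_kernel[OF matrix_vector_mul_linear] by blast
  moreover have "subspace (range ?L)" using lin by (intro linear_subspace_image) auto
  ultimately have "range ?L = ?N" using sub by (intro subspace_dim_equal) auto
  moreover have "(\<chi> k. edge_displacement e p x k) = 0" using x by (simp add: vec_eq_iff)
  then have "flatten x \<in> ?N" by (simp add: rigidity_matrix_mult_flatten[OF e])
  ultimately have "flatten x \<in> range ?L" by simp
  then obtain c s where "flatten x = flatten (\<chi> i. s *\<^sub>R p $ i + c)" by auto
  then have "x $ i = s *\<^sub>R p $ i + c" for i by simp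
  then show ?thesis by (rule that)
qed

text \<open>By rigidity the extended error is a scaling plus a translation of \<open>p\<close>. It
  vanishes at two leaders in distinct places, so the scaling factor is zero, and then the
  translation.\<close>

lemma edge_displacement_followers_eq_0:
  fixes p :: "real^'d::finite^('l::finite + 'f::finite)"
  assumes "\<And>k. fst (e k) \<noteq> snd (e k)" and distinct: "\<And>i j. i \<noteq> j \<Longrightarrow> p $ i \<noteq> p $ j"
    and "infinitesimally_bearing_rigid e p" and l: "CARD('l) \<ge> 2"
    and "\<And>k. edge_displacement e p (configuration 0 y) k = 0"
  shows "y = 0"
proof -
  have "CARD('l + 'f) \<ge> 2" using l by simp
  then obtain s c where sc: "\<And>i. configuration 0 y $ i = s *\<^sub>R p $ i + c"
    using rigid_kernel[OF assms(1-3) _ assms(5)] by blast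
  obtain i j :: 'l where "i \<noteq> j" using l by (rule two_distinct_elements)
  have "s *\<^sub>R p $ Inl i + c = 0" "s *\<^sub>R p $ Inl j + c = 0" using sc[of "Inl i"] sc[of "Inl j"] by simp_all
  then have "s *\<^sub>R p $ Inl i + c = s *\<^sub>R p $ Inl j + c" by simp
  then have "s = 0" using distinct[of "Inl i" "Inl j"] \<open>i \<noteq> j\<close> by simp
  moreover from this have "c = 0" using sc[of "Inl i"] by simp
  ultimately have "y $ b = 0" for b using sc[of "Inr b"] by simp
  then show ?thesis by (simp add: vec_eq_iff)
qed

text \<open>The first claim turns triviality of the kernel into positivity of \<open>\<mu>\<close>;
  the second is the Rayleigh bound, the quantitative form in which rigidity is used later.\<close>

lemma follower_block_definite:
  fixes p :: "real^'d::finite^('l::finite + 'f::finite)"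
  assumes "\<And>k. fst (e k) \<noteq> snd (e k)" and "\<And>i j. i \<noteq> j \<Longrightarrow> p $ i \<noteq> p $ j"
    and "infinitesimally_bearing_rigid e p" and "CARD('l) \<ge> 2"
  defines "\<mu> \<equiv> lambda_min (follower_block (bearing_laplacian e p))"
  shows "0 < \<mu>"
    and "\<mu> * (norm y)\<^sup>2 \<le> (\<Sum>k\<in>UNIV. (norm (edge_displacement e p (configuration 0 y) k))\<^sup>2)"
proof -
  note form = inner_follower_block[of _ "bearing_laplacian e p"] inner_bearing_laplacian[OF assms(1)]
  show "0 < \<mu>" unfolding \<mu>_def
  proof (rule lambda_min_pos[OF transpose_follower_block_bearing_laplacian])
    fix x :: "real^('f \<times> 'd)" assume "x \<noteq> 0"
    obtain y where y: "x = flatten y" by (rule surj_flatten)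
    with \<open>x \<noteq> 0\<close> have "y \<noteq> 0" by auto
    then obtain k where "edge_displacement e p (configuration 0 y) k \<noteq> 0"
      using edge_displacement_followers_eq_0[OF assms(1-4)] by blast
    then have "0 < (\<Sum>k\<in>UNIV. (norm (edge_displacement e p (configuration 0 y) k))\<^sup>2)"
      by (intro sum_pos2[of _ k]) auto
    then show "0 < x \<bullet> (follower_block (bearing_laplacian e p) *v x)" unfolding y form .
  qed
  show "\<mu> * (norm y)\<^sup>2 \<le> (\<Sum>k\<in>UNIV. (norm (edge_displacement e p (configuration 0 y) k))\<^sup>2)"
    using lambda_min_symmetric(2)[OF transpose_follower_block_bearing_laplacian, of e p "flatten y"]
    unfolding form by (simp add: \<mu>_def power2_norm_eq_inner)
qed

section \<open>The closed loop\<close>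

text \<open>The unordered endpoint pair determines the edge, so the description in
  \<open>edge_index\<close> is unique in either orientation.\<close>

lemma edge_index_edge:
  assumes "simple_graph e"
  shows "edge_index e (fst (e k)) (snd (e k)) = k" "edge_index e (snd (e k)) (fst (e k)) = k"
proof -
  have *: "k' = k" if "e k' = (fst (e k), snd (e k)) \<or> e k' = (snd (e k), fst (e k))" for k'
  proof -
    have "{fst (e k'), snd (e k')} = {fst (e k), snd (e k)}" using that by auto
    moreover have "inj (\<lambda>k. {fst (e k), snd (e k)})" using assms by (simp add: simple_graph_def)
    ultimately show ?thesis by (simp add: inj_def)
  qed
  show "edge_index e (fst (e k)) (snd (e k)) = k" unfolding edge_index_def
  proof (rule the_equality)
    show "e k = (fst (e k), snd (e k)) \<or> e k = (snd (e k), fst (e k))" by simp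
  qed (rule *)
  show "edge_index e (snd (e k)) (fst (e k)) = k" unfolding edge_index_def
  proof (rule the_equality)
    show "e k = (snd (e k), fst (e k)) \<or> e k = (fst (e k), snd (e k))" by simp
  qed (rule *, erule disj_commute[THEN iffD1])
qed

text \<open>Pairs of a vertex and a neighbor are the edges in both orientations. The two families
  are disjoint, since an edge equal to a reversed edge would be a loop.\<close>

lemma sum_neighbors_eq_sum_edges:
  fixes e :: "'m::finite \<Rightarrow> 'n::finite \<times> 'n"
  assumes e: "simple_graph e"
  shows "(\<Sum>i\<in>UNIV. \<Sum>j\<in>neighbors e i. h (edge_index e i j) i j) =
    (\<Sum>k\<in>UNIV. h k (fst (e k)) (snd (e k)) + h k (snd (e k)) (fst (e k)))"
proof -
  let ?h = "\<lambda>(i, j). h (edge_index e i j) i j"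
  have inj: "inj e"
  proof (rule injI)
    fix k k' assume "e k = e k'"
    then have "edge_index e (fst (e k)) (snd (e k)) = edge_index e (fst (e k')) (snd (e k'))" by simp
    then show "k = k'" unfolding edge_index_edge[OF e] .
  qed
  then have inj': "inj (prod.swap \<circ> e)" by (simp add: inj_compose)
  have "(SIGMA i:UNIV. neighbors e i) = range e \<union> range (prod.swap \<circ> e)"
  proof (rule set_eqI)
    fix z
    have "z \<in> (SIGMA i:UNIV. neighbors e i) \<longleftrightarrow> (\<exists>k. e k = z \<or> e k = prod.swap z)"
      by (cases z) (simp add: neighbors_def)
    also have "\<dots> \<longleftrightarrow> (\<exists>k. z = e k \<or> z = prod.swap (e k))" by (metis swap_swap)
    also have "\<dots> \<longleftrightarrow> z \<in> range e \<union> range (prod.swap \<circ> e)" by auto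
    finally show "z \<in> (SIGMA i:UNIV. neighbors e i) \<longleftrightarrow> z \<in> range e \<union> range (prod.swap \<circ> e)" .
  qed
  moreover have "range e \<inter> range (prod.swap \<circ> e) = {}"
  proof -
    have "e k \<noteq> prod.swap (e k')" for k k'
    proof
      assume *: "e k = prod.swap (e k')"
      then have "edge_index e (fst (e k)) (snd (e k)) = edge_index e (snd (e k')) (fst (e k'))" by simp
      then have "k = k'" unfolding edge_index_edge[OF e] .
      with * have "fst (e k) = snd (e k)" by (metis fst_swap)
      with e show False unfolding simple_graph_def by blast
    qed
    then show ?thesis unfolding disjoint_iff by (metis comp_apply rangeE)
  qed
  ultimately have "sum ?h (SIGMA i:UNIV. neighbors e i) = sum ?h (range e) + sum ?h (range (prod.swap \<circ> e))"
    by (simp add: sum.union_disjoint)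
  also have "\<dots> = (\<Sum>k\<in>UNIV. h k (fst (e k)) (snd (e k)) + h k (snd (e k)) (fst (e k)))"
    unfolding sum.reindex[OF inj] sum.reindex[OF inj']
    by (simp add: case_prod_unfold edge_index_edge[OF e] sum.distrib)
  finally show ?thesis by (subst sum.Sigma) auto
qed

section \<open>The componentwise sign and the control summed over edges\<close>

lemma sgn_comp_uminus [simp]: "sgn_comp (- y) = - sgn_comp y"
  by (simp add: sgn_comp_def vec_eq_iff sgn_minus)

lemma inner_sgn_comp_self: "y \<bullet> sgn_comp y = norm1 y"
  by (simp add: inner_vec_def sgn_comp_def norm1_def mult_sgn_abs abs_sgn mult.commute)

lemma norm1_nonneg [simp]: "0 \<le> norm1 y"
  by (simp add: norm1_def sum_nonneg)

lemma norm_sgn_comp_le: "norm (sgn_comp (y :: real^'d::finite)) \<le> CARD('d)"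
proof -
  have "norm (sgn_comp y) \<le> (\<Sum>a\<in>UNIV. \<bar>sgn_comp y $ a\<bar>)" by (rule norm_le_l1_cart)
  also have "\<dots> \<le> (\<Sum>a\<in>(UNIV :: 'd set). 1)" by (intro sum_mono) (simp add: sgn_comp_def abs_sgn_eq)
  finally show ?thesis by simp
qed

text \<open>The weight is frozen at \<open>x\<close>: an entry of \<open>h x\<close> that is zero
  annihilates its jumping sign, and at a nonzero entry the sign is continuous.\<close>

lemma isCont_inner_sgn_comp:
  fixes h :: "'a::t2_space \<Rightarrow> real^'d::finite"
  assumes "isCont h x"
  shows "isCont (\<lambda>z. h x \<bullet> sgn_comp (h z)) x"
proof -
  have "isCont (\<lambda>z. h x $ a * sgn (h z $ a)) x" for a
  proof (cases "h x $ a = 0")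
    case False
    have "isCont (\<lambda>z. h z $ a) x" using assms by (intro continuous_intros)
    then have "(\<lambda>z. sgn (h z $ a)) \<midarrow>x\<rightarrow> sgn (h x $ a)" using False unfolding isCont_def by (rule tendsto_sgn)
    then show ?thesis unfolding isCont_def by (rule tendsto_mult_left)
  qed simp
  then show ?thesis by (simp add: inner_vec_def sgn_comp_def)
qed

lemma q_vec_edge: "q_vec ps p (fst (e k)) (snd (e k)) = edge_displacement e (ps 0) p k"
  by (simp add: q_vec_def edge_displacement_def)

lemma q_vec_commute: "q_vec ps p j i = - q_vec ps p i j"
  by (simp add: q_vec_def bearing_commute[of "ps 0" j i] matrix_vector_mult_diff_distrib)

text \<open>Each edge contributes from both ends with the same gain and opposite signs, so the two
  terms combine to the displacement of the test vector \<open>w\<close> along the edge.\<close>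

lemma sum_inner_control:
  fixes e :: "'m::finite \<Rightarrow> 'n::finite \<times> 'n" and w :: "real^'d::finite^'n"
  assumes "simple_graph e"
  shows "(\<Sum>i\<in>UNIV. w $ i \<bullet> control e ps \<gamma> p i) =
    - (\<Sum>k\<in>UNIV. \<gamma> $ k * (edge_displacement e (ps 0) w k \<bullet> sgn_comp (edge_displacement e (ps 0) p k)))"
proof -
  define h where "h k i j = \<gamma> $ k * ((proj_orth (bearing (ps 0) i j) *v w $ i) \<bullet> sgn_comp (q_vec ps p i j))" for k i j
  have "h k (fst (e k)) (snd (e k)) + h k (snd (e k)) (fst (e k)) =
      \<gamma> $ k * (edge_displacement e (ps 0) w k \<bullet> sgn_comp (edge_displacement e (ps 0) p k))" for k
  proof -
    have "q_vec ps p (snd (e k)) (fst (e k)) = - edge_displacement e (ps 0) p k"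
      using q_vec_commute[of ps p "snd (e k)" "fst (e k)"] by (simp add: q_vec_edge)
    moreover have "proj_orth (bearing (ps 0) (snd (e k)) (fst (e k))) = proj_orth (bearing (ps 0) (fst (e k)) (snd (e k)))"
      using bearing_commute[of "ps 0" "snd (e k)" "fst (e k)"] by simp
    ultimately show ?thesis
      by (simp add: h_def q_vec_edge edge_displacement_def[of e "ps 0" w] matrix_vector_mult_diff_distrib
          inner_diff_left right_diff_distrib)
  qed
  moreover have "(\<Sum>i\<in>UNIV. w $ i \<bullet> control e ps \<gamma> p i) = - (\<Sum>i\<in>UNIV. \<Sum>j\<in>neighbors e i. h (edge_index e i j) i j)"
    by (simp add: control_def h_def inner_sum_right inner_proj_orth sum_negf)
  ultimately show ?thesis unfolding sum_neighbors_eq_sum_edges[OF assms, of h] by simp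
qed

lemma norm_vec_le_sum: "norm (x :: 'a::real_normed_vector^'n::finite) \<le> (\<Sum>i\<in>UNIV. norm (x $ i))"
  unfolding norm_vec_def by (intro L2_set_le_sum) auto

lemma norm_proj_orth_bearing_le: "norm (proj_orth (bearing p i j) *v s) \<le> 2 * norm s"
proof -
  let ?g = "bearing p i j"
  \<comment> \<open>For coincident points the bearing is zero, because division by zero yields
    zero.\<close>
  have g: "norm ?g \<le> 1" by (cases "p $ j = p $ i") (simp_all add: bearing_def)
  have "norm ((?g \<bullet> s) *\<^sub>R ?g) \<le> 1 * norm s * 1"
    using Cauchy_Schwarz_ineq2[of ?g s] g mult_right_mono[OF g norm_ge_zero[of s]] norm_ge_zero[of ?g] norm_ge_zero[of s]
    unfolding norm_scaleR by (intro mult_mono) linarith+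
  then show ?thesis
    unfolding proj_orth_mult using norm_triangle_ineq4[of s "(?g \<bullet> s) *\<^sub>R ?g"] by simp
qed

text \<open>The sign is bounded, so the bound does not depend on the positions; bounded gains will
  therefore give a Lipschitz error.\<close>

lemma norm_control_le:
  fixes p :: "real^'d::finite^'n::finite" and \<Gamma> :: real
  assumes "\<And>k. \<bar>\<gamma> $ k\<bar> \<le> \<Gamma>" "0 \<le> \<Gamma>"
  shows "norm (control e ps \<gamma> p i) \<le> CARD('n) * (\<Gamma> * (2 * CARD('d)))"
proof -
  have "norm (control e ps \<gamma> p i) \<le> (\<Sum>j\<in>neighbors e i.
      norm (\<gamma> $ edge_index e i j *\<^sub>R (proj_orth (bearing (ps 0) i j) *v sgn_comp (q_vec ps p i j))))"
    by (simp add: control_def norm_sum del: norm_scaleR)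
  also have "\<dots> \<le> (\<Sum>j\<in>neighbors e i. \<Gamma> * (2 * CARD('d)))"
  proof (rule sum_mono)
    fix j
    have "norm (proj_orth (bearing (ps 0) i j) *v sgn_comp (q_vec ps p i j)) \<le> 2 * CARD('d)"
      using norm_proj_orth_bearing_le[of "ps 0" i j "sgn_comp (q_vec ps p i j)"]
        norm_sgn_comp_le[of "q_vec ps p i j"] by linarith
    then show "norm (\<gamma> $ edge_index e i j *\<^sub>R (proj_orth (bearing (ps 0) i j) *v sgn_comp (q_vec ps p i j)))
        \<le> \<Gamma> * (2 * CARD('d))"
      unfolding norm_scaleR using assms by (intro mult_mono) auto
  qed
  also have "\<dots> \<le> CARD('n) * (\<Gamma> * (2 * CARD('d)))"
    using assms(2) by (simp add: card_mono mult_right_mono)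
  finally show ?thesis .
qed

section \<open>Filippov velocities of the closed loop\<close>

lemma isCont_configuration_nth:
  "isCont (\<lambda>z. configuration pl (fst z) $ i) (x :: (real^'d::finite^'f::finite) \<times> 'b::t2_space)"
  by (cases i) (auto intro!: continuous_intros)

lemma edge_displacement_diff:
  "edge_displacement e p (x - x') k = edge_displacement e p x k - edge_displacement e p x' k"
  by (simp add: edge_displacement_def matrix_vector_mult_diff_distrib algebra_simps)

lemma isCont_edge_displacement_configuration:
  "isCont (\<lambda>z. edge_displacement e p (configuration pl (fst z)) k) (x :: (real^'d::finite^'f::finite) \<times> 'b::t2_space)"
  unfolding edge_displacement_def
  by (intro isCont_o2[OF _ linear_continuous_at[OF matrix_vector_mul_bounded_linear]]
      continuous_intros isCont_configuration_nth)

text \<open>Extending \<open>y\<close> by zero turns the sum over followers into a sum over all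
  agents, to which the edge formula applies.\<close>

lemma inner_closed_loop_fst:
  assumes "simple_graph e"
  shows "(y, 0) \<bullet> closed_loop e ps d \<kappa> t z =
    - (\<Sum>k\<in>UNIV. snd z $ k * (edge_displacement e (ps 0) (configuration 0 y) k \<bullet>
          sgn_comp (edge_displacement e (ps 0) (configuration (ps t) (fst z)) k)))
    + y \<bullet> followers (d t)"
  unfolding sum_inner_control[OF assms, symmetric]
  by (simp add: closed_loop_def Let_def sum_UNIV_Plus)
    (simp add: inner_vec_def followers_def inner_add_right sum.distrib inner_sum_right distrib_left)

lemma inner_closed_loop_snd:
  "(0, axis k 1) \<bullet> closed_loop e ps d \<kappa> t z =
    \<kappa> * norm1 (edge_displacement e (ps 0) (configuration (ps t) (fst z)) k)"
  by (simp add: closed_loop_def Let_def inner_axis' q_vec_edge)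

text \<open>Both claims test the inclusion in a direction of continuity: the error itself, and a
  single gain. Assumption \<open>q\<close> ensures that the coefficients of the test vector vanish
  exactly in the entries whose sign may jump.\<close>

lemma filippov_closed_loop:
  fixes e :: "'m::finite \<Rightarrow> ('l::finite + 'f::finite) \<times> ('l + 'f)" and ps :: "real \<Rightarrow> real^'d::finite^('l + 'f)"
  assumes e: "simple_graph e"
    and x': "x' \<in> filippov_map (closed_loop e ps d \<kappa>) t x"
    and q: "\<And>k. edge_displacement e (ps 0) (configuration (ps t) (fst x)) k = edge_displacement e (ps 0) (configuration 0 y) k"
  shows "y \<bullet> fst x' = - (\<Sum>k\<in>UNIV. snd x $ k * norm1 (edge_displacement e (ps 0) (configuration 0 y) k)) + y \<bullet> followers (d t)"
    and "snd x' $ k = \<kappa> * norm1 (edge_displacement e (ps 0) (configuration 0 y) k)"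
proof -
  have "isCont (\<lambda>z. snd z $ k * (edge_displacement e (ps 0) (configuration 0 y) k \<bullet>
          sgn_comp (edge_displacement e (ps 0) (configuration (ps t) (fst z)) k))) x" for k
  proof (rule isCont_mult)
    show "isCont (\<lambda>z. snd z $ k) x" by (intro continuous_intros)
    show "isCont (\<lambda>z. edge_displacement e (ps 0) (configuration 0 y) k \<bullet>
        sgn_comp (edge_displacement e (ps 0) (configuration (ps t) (fst z)) k)) x"
      using isCont_inner_sgn_comp[OF isCont_edge_displacement_configuration[of x e "ps 0" "ps t" k]]
      unfolding q .
  qed
  then have "isCont (\<lambda>z. (y, 0) \<bullet> closed_loop e ps d \<kappa> t z) x"
    unfolding inner_closed_loop_fst[OF e]
    by (intro continuous_add continuous_minus continuous_sum continuous_const)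
  from filippov_map_inner_eq[OF x' this]
  show "y \<bullet> fst x' = - (\<Sum>k\<in>UNIV. snd x $ k * norm1 (edge_displacement e (ps 0) (configuration 0 y) k)) + y \<bullet> followers (d t)"
    unfolding inner_closed_loop_fst[OF e] q inner_sgn_comp_self by (simp add: inner_prod_def)
  have "isCont (\<lambda>z. (0, axis k 1) \<bullet> closed_loop e ps d \<kappa> t z) x"
    unfolding inner_closed_loop_snd norm1_def
    by (intro continuous_intros isCont_edge_displacement_configuration)
  from filippov_map_inner_eq[OF x' this]
  show "snd x' $ k = \<kappa> * norm1 (edge_displacement e (ps 0) (configuration 0 y) k)"
    unfolding inner_closed_loop_snd q by (simp add: inner_prod_def inner_axis')
qed

lemma filippov_closed_loop_norm_le:
  fixes e :: "'m::finite \<Rightarrow> ('l::finite + 'f::finite) \<times> ('l + 'f)" and ps :: "real \<Rightarrow> real^'d::finite^('l + 'f)"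
    and \<Gamma> D :: real
  assumes x': "x' \<in> filippov_map (closed_loop e ps d \<kappa>) t x"
    and \<Gamma>: "norm (snd x) \<le> \<Gamma>" and D: "norm (d t) \<le> D"
  shows "norm (fst x') \<le> CARD('f) * (CARD('l + 'f) * ((\<Gamma> + 1) * (2 * CARD('d))) + D)"
proof -
  let ?B = "CARD('f) * (CARD('l + 'f) * ((\<Gamma> + 1) * (2 * CARD('d))) + D)"
  \<comment> \<open>Only the follower velocities are confined; the second factor leaves the gain
    rates free.\<close>
  let ?C = "cball (0 :: real^'d^'f) ?B \<times> (UNIV :: (real^'m) set)"
  have "x' \<in> ?C"
  proof (rule filippov_map_closed_convex[OF x' zero_less_one])
    show "closed ?C" "convex ?C" by (simp_all add: closed_Times convex_Times)
    show "closed_loop e ps d \<kappa> t ` ball x 1 \<subseteq> ?C"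
    proof (rule image_subsetI)
      fix z assume "z \<in> ball x 1"
      \<comment> \<open>In the unit ball the gains differ from those of the state by at most one,
        hence the constant \<open>\<Gamma> + 1\<close>.\<close>
      then have "norm (snd z - snd x) \<le> 1"
        using dist_snd_le[of z x] by (simp add: dist_norm norm_minus_commute[of x z])
      then have "norm (snd z) \<le> \<Gamma> + 1" using \<Gamma> norm_triangle_sub[of "snd z" "snd x"] by linarith
      then have \<gamma>: "\<bar>snd z $ k\<bar> \<le> \<Gamma> + 1" for k using component_le_norm_cart[of "snd z" k] by linarith
      have "0 \<le> \<Gamma> + 1" using \<Gamma> norm_ge_zero[of "snd x"] by linarith
      note c = norm_control_le[OF \<gamma> this]
      have "norm (fst (closed_loop e ps d \<kappa> t z)) \<le> (\<Sum>i\<in>UNIV. norm (fst (closed_loop e ps d \<kappa> t z) $ i))"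
        by (rule norm_vec_le_sum)
      also have "\<dots> \<le> (\<Sum>i\<in>(UNIV :: 'f set). CARD('l + 'f) * ((\<Gamma> + 1) * (2 * CARD('d))) + D)"
      proof (rule sum_mono)
        fix i :: 'f
        have "norm (d t $ Inr i) \<le> D" using Finite_Cartesian_Product.norm_nth_le[of "d t" "Inr i"] D by linarith
        with c[of e ps "configuration (ps t) (fst z)" "Inr i"]
        show "norm (fst (closed_loop e ps d \<kappa> t z) $ i) \<le> CARD('l + 'f) * ((\<Gamma> + 1) * (2 * CARD('d))) + D"
          unfolding closed_loop_def Let_def fst_conv vec_lambda_beta by (intro norm_triangle_le add_mono)
      qed
      also have "\<dots> = ?B" by simp
      finally have "fst (closed_loop e ps d \<kappa> t z) \<in> cball 0 ?B" by simp
      then show "closed_loop e ps d \<kappa> t z \<in> ?C" by (simp add: mem_Times_iff)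
    qed
  qed
  then show ?thesis by (simp add: mem_Times_iff)
qed

section \<open>Supremum norms and monotone limits\<close>

lemma infnorm_upper_sup_infnorm:
  assumes "bounded (w ` {0..})" "0 \<le> t"
  shows "infnorm (w t) \<le> sup_infnorm w"
  unfolding sup_infnorm_def
proof (rule cSUP_upper)
  obtain B where "\<And>t. t \<ge> 0 \<Longrightarrow> norm (w t) \<le> B" using assms(1) by (auto simp: bounded_iff)
  then show "bdd_above ((\<lambda>t. infnorm (w t)) ` {0..})"
    by (intro bdd_aboveI2[of _ _ B]) (auto intro: order_trans[OF infnorm_le_norm])
qed (use assms in auto)

lemma abs_entry_le_infnorm: "\<bar>x $ i $ a\<bar> \<le> infnorm (x :: real^'d::finite^'n::finite)"
  using Basis_le_infnorm[of "axis i (axis a 1)" x] by (simp add: inner_axis axis_in_Basis_iff)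

lemma infnorm_le_entries:
  assumes "\<And>i a. \<bar>x $ i $ a\<bar> \<le> M"
  shows "infnorm (x :: real^'d::finite^'n::finite) \<le> M"
  unfolding infnorm_Max
proof (rule Max.boundedI)
  fix r assume "r \<in> (\<lambda>b. \<bar>x \<bullet> b\<bar>) ` Basis"
  then obtain i a where "r = \<bar>x \<bullet> axis i (axis a 1)\<bar>" by (auto simp: Basis_vec_def)
  then show "r \<le> M" using assms[of i a] by (simp add: inner_axis)
qed auto

lemma increasing_bounded_tendsto:
  fixes f :: "real \<Rightarrow> real"
  assumes mono: "\<And>s t. 0 \<le> s \<Longrightarrow> s \<le> t \<Longrightarrow> f s \<le> f t" and bdd: "\<And>t. 0 \<le> t \<Longrightarrow> f t \<le> B"
  obtains l where "(f \<longlongrightarrow> l) at_top"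
proof -
  have bdd': "bdd_above (f ` {0..})" using bdd by (intro bdd_aboveI2[of _ _ B]) auto
  have "(f \<longlongrightarrow> (SUP t\<in>{0..}. f t)) at_top"
  proof (rule increasing_tendsto)
    show "eventually (\<lambda>t. f t \<le> (SUP t\<in>{0..}. f t)) at_top"
      using eventually_ge_at_top[of 0] by eventually_elim (auto intro: cSUP_upper[OF _ bdd'])
    fix x assume "x < (SUP t\<in>{0..}. f t)"
    then obtain s where s: "s \<ge> 0" "x < f s" using less_cSUP_iff[OF _ bdd'] by auto
    show "eventually (\<lambda>t. x < f t) at_top"
      using eventually_ge_at_top[of s] by eventually_elim (use s mono in force)
  qed
  then show ?thesis by (rule that)
qed

lemma bounded_linear_replicate: "bounded_linear (\<lambda>c. (\<chi> i. c) :: real^'d::finite^'f::finite)"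
  by (rule linear_conv_bounded_linear[THEN iffD1], rule linearI) (auto simp: vec_eq_iff)

section \<open>Solutions\<close>

locale closed_loop_solution =
  fixes e :: "'m::finite \<Rightarrow> ('l::finite + 'f::finite) \<times> ('l + 'f)"
    and v :: "real \<Rightarrow> real^'d::finite"
    and ps p d :: "real \<Rightarrow> real^'d^('l + 'f)"
    and \<gamma> :: "real \<Rightarrow> real^'m"
    and \<kappa> :: real
  assumes two_leaders: "CARD('l) \<ge> 2"
    and simple: "simple_graph e"
    and distinct: "\<And>i j. i \<noteq> j \<Longrightarrow> ps 0 $ i \<noteq> ps 0 $ j"
    and rigid: "infinitesimally_bearing_rigid e (ps 0)"
    and v_bounded: "bounded (v ` {0..})" and v_continuous: "continuous_on {0..} v"
    and target: "\<And>t i. t \<ge> 0 \<Longrightarrow> ps t $ i = ps 0 $ i + integral {0..t} v"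
    and d_bounded: "bounded (d ` {0..})"
    and \<kappa>_pos: "\<kappa> > 0"
    and solution: "filippov_solution (closed_loop e ps d \<kappa>) (\<lambda>t. (followers (p t), \<gamma> t))"
begin

definition y :: "real \<Rightarrow> real^'d^'f" where
  "y t = followers (p t) - followers (ps t)"

definition q :: "real \<Rightarrow> 'm \<Rightarrow> real^'d" where
  "q t k = edge_displacement e (ps 0) (configuration 0 (y t)) k"

definition \<mu> :: real where
  "\<mu> = lambda_min (follower_block (bearing_laplacian e (ps 0)))"

definition \<gamma>0 :: real where
  "\<gamma>0 = (sup_infnorm d + sup_infnorm v) * sqrt (real (CARD('d) * CARD('l + 'f)) / \<mu>)"

text \<open>A common bound for the target velocity and the disturbance at nonnegative times;
  \<open>norm_le_B\<close> justifies the choice.\<close>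

definition B :: real where
  "B = (SOME B. \<forall>t\<ge>0. norm (v t) \<le> B \<and> norm (d t) \<le> B)"

section \<open>Estimates for the error and the disturbance\<close>

lemma no_loops: "fst (e k) \<noteq> snd (e k)"
  using simple by (simp add: simple_graph_def)

lemma norm_le_B:
  assumes "t \<ge> 0"
  shows "norm (v t) \<le> B" "norm (d t) \<le> B"
proof -
  obtain Bv Bd where "\<And>t. t \<ge> 0 \<Longrightarrow> norm (v t) \<le> Bv" "\<And>t. t \<ge> 0 \<Longrightarrow> norm (d t) \<le> Bd"
    using v_bounded d_bounded by (auto simp: bounded_iff)
  then have "\<forall>t\<ge>0. norm (v t) \<le> max Bv Bd \<and> norm (d t) \<le> max Bv Bd" by (simp add: le_max_iff_disj)
  then have "\<forall>t\<ge>0. norm (v t) \<le> B \<and> norm (d t) \<le> B"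
    unfolding B_def by (rule someI[of "\<lambda>B. \<forall>t\<ge>0. norm (v t) \<le> B \<and> norm (d t) \<le> B"])
  with assms show "norm (v t) \<le> B" "norm (d t) \<le> B" by auto
qed

lemma B_nonneg: "B \<ge> 0"
  using norm_le_B(1)[of 0] norm_ge_zero[of "v 0"] by linarith

lemma \<mu>_pos: "0 < \<mu>"
  unfolding \<mu>_def by (rule follower_block_definite(1)[OF no_loops distinct rigid two_leaders])

lemma sup_infnorm_add_nonneg: "0 \<le> sup_infnorm d + sup_infnorm v"
  using infnorm_upper_sup_infnorm[OF d_bounded order_refl] infnorm_upper_sup_infnorm[OF v_bounded order_refl]
    infnorm_pos_le[of "d 0"] infnorm_pos_le[of "v 0"] by linarith

lemma \<gamma>0_nonneg: "0 \<le> \<gamma>0"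
  using \<mu>_pos unfolding \<gamma>0_def by (intro mult_nonneg_nonneg sup_infnorm_add_nonneg) simp

text \<open>The target only translates, so at every time its own displacement is annihilated by the
  constant projections. Hence the projections of the state are those of the error.\<close>

lemma edge_displacement_state:
  assumes "t \<ge> 0"
  shows "edge_displacement e (ps 0) (configuration (ps t) (followers (p t))) k = q t k"
proof -
  have "configuration 0 (y t) $ i = (configuration (ps t) (followers (p t)) - ps t) $ i" for i
    by (cases i) (simp_all add: y_def followers_def)
  then have "configuration 0 (y t) = configuration (ps t) (followers (p t)) - ps t"
    unfolding vec_eq_iff[of "configuration 0 (y t)"] by blast
  moreover have "edge_displacement e (ps 0) (ps t) k =
      - (proj_orth (bearing (ps 0) (fst (e k)) (snd (e k))) *v (ps 0 $ snd (e k) - ps 0 $ fst (e k)))"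
    by (simp add: edge_displacement_def target[OF assms, of "fst (e k)"] target[OF assms, of "snd (e k)"]
        matrix_vector_mult_diff_distrib)
  then have "edge_displacement e (ps 0) (ps t) k = 0"
    using proj_orth_bearing_self[OF distinct[OF no_loops]] by simp
  ultimately show ?thesis by (simp add: q_def edge_displacement_diff)
qed

text \<open>The Rayleigh bound controls the error by the Euclidean norm of the stacked edge vectors,
  which is at most the sum of their norms and hence of their 1-norms.\<close>

lemma norm_y_le: "sqrt \<mu> * norm (y t) \<le> (\<Sum>k\<in>UNIV. norm1 (q t k))"
proof -
  have "(norm (\<chi> k. q t k))\<^sup>2 = (\<Sum>k\<in>UNIV. (norm (q t k))\<^sup>2)"
    by (simp add: power2_norm_eq_inner) (simp add: inner_vec_def)
  then have "\<mu> * (norm (y t))\<^sup>2 \<le> (norm (\<chi> k. q t k))\<^sup>2"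
    using follower_block_definite(2)[OF no_loops distinct rigid two_leaders, of "y t"]
    unfolding \<mu>_def[symmetric] q_def[symmetric] by simp
  then have "sqrt (\<mu> * (norm (y t))\<^sup>2) \<le> norm (\<chi> k. q t k)"
    using real_sqrt_le_mono by fastforce
  then have "sqrt \<mu> * norm (y t) \<le> norm (\<chi> k. q t k)" by (simp add: real_sqrt_mult)
  also have "\<dots> \<le> (\<Sum>k\<in>UNIV. norm ((\<chi> k. q t k) $ k))" by (rule norm_vec_le_sum)
  also have "\<dots> \<le> (\<Sum>k\<in>UNIV. norm1 (q t k))"
    unfolding norm1_def by (intro sum_mono) (simp add: norm_le_l1_cart)
  finally show ?thesis .
qed

text \<open>The threshold is made for this estimate: the joint disturbance has norm at most
  \<open>\<gamma>0 * sqrt \<mu>\<close>, and \<open>norm_y_le\<close> trades the factor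
  \<open>sqrt \<mu>\<close> for the edge sum.\<close>

lemma disturbance_le:
  assumes "t \<ge> 0"
  shows "y t \<bullet> followers (d t) - y t \<bullet> (\<chi> i. v t) \<le> \<gamma>0 * (\<Sum>k\<in>UNIV. norm1 (q t k))"
proof -
  let ?M = "sup_infnorm d + sup_infnorm v" and ?w = "followers (d t) - (\<chi> i. v t)"
  have "infnorm ?w \<le> ?M"
  proof (rule infnorm_le_entries)
    fix i a
    have "\<bar>d t $ Inr i $ a\<bar> \<le> sup_infnorm d"
      using abs_entry_le_infnorm infnorm_upper_sup_infnorm[OF d_bounded assms] order_trans by blast
    moreover have "\<bar>v t $ a\<bar> \<le> sup_infnorm v"
      using component_le_infnorm_cart infnorm_upper_sup_infnorm[OF v_bounded assms] order_trans by blast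
    ultimately show "\<bar>?w $ i $ a\<bar> \<le> ?M" by (simp add: followers_def)
  qed
  have "norm ?w \<le> sqrt (real (CARD('f) * CARD('d))) * infnorm ?w"
    using norm_le_infnorm[of ?w] by simp
  also have "\<dots> \<le> sqrt (real (CARD('f) * CARD('d))) * ?M"
    by (rule mult_left_mono[OF \<open>infnorm ?w \<le> ?M\<close>]) simp
  \<comment> \<open>The count of follower coordinates is enlarged to that of all agents, as it
    appears in the threshold.\<close>
  also have "\<dots> \<le> sqrt (real (CARD('d) * CARD('l + 'f))) * ?M"
    using sup_infnorm_add_nonneg by (intro mult_right_mono real_sqrt_le_mono) (simp_all add: algebra_simps)
  also have "\<dots> = \<gamma>0 * sqrt \<mu>"
    using \<mu>_pos by (simp add: \<gamma>0_def real_sqrt_divide)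
  finally have w: "norm ?w \<le> \<gamma>0 * sqrt \<mu>" .
  have "y t \<bullet> ?w \<le> norm (y t) * norm ?w" by (rule norm_cauchy_schwarz)
  also have "\<dots> \<le> \<gamma>0 * (sqrt \<mu> * norm (y t))"
    using mult_left_mono[OF w norm_ge_zero[of "y t"]] by (simp add: mult_ac)
  also have "\<dots> \<le> \<gamma>0 * (\<Sum>k\<in>UNIV. norm1 (q t k))"
    by (intro mult_left_mono norm_y_le \<gamma>0_nonneg)
  finally show ?thesis by (simp add: inner_diff_right)
qed

lemma integral_v_lipschitz:
  assumes "0 \<le> s" "s \<le> t"
  shows "norm (integral {0..t} v - integral {0..s} v) \<le> B * (t - s)"
proof -
  have cont: "continuous_on {a..b} v" if "0 \<le> a" for a b
    using v_continuous that by (auto intro: continuous_on_subset)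
  have "integral {0..s} v + integral {s..t} v = integral {0..t} v"
    using assms cont[of 0 t] by (intro Henstock_Kurzweil_Integration.integral_combine integrable_continuous_real) auto
  then have "integral {0..t} v - integral {0..s} v = integral {s..t} v" by (simp add: algebra_simps)
  moreover have "norm (integral {s..t} v) \<le> B * (t - s)"
    using assms norm_le_B(1) cont[of s t] by (intro integral_bound) auto
  ultimately show ?thesis by simp
qed

lemma followers_target:
  assumes "t \<ge> 0"
  shows "followers (ps t) = followers (ps 0) + (\<chi> i. integral {0..t} v)"
  using target[OF assms] by (simp add: followers_def vec_eq_iff)

lemma followers_target_derivative:
  assumes t: "t \<ge> 0"
  shows "((\<lambda>t. followers (ps t)) has_vector_derivative (\<chi> i. v t)) (at t within {0..})"
proof -
  \<comment> \<open>Reaching one unit beyond \<open>t\<close> makes the interval a neighbourhood of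
    \<open>t\<close> in the half-line.\<close>
  have "((\<lambda>t. integral {0..t} v) has_vector_derivative v t) (at t within {0..t + 1})"
    using t v_continuous by (intro integral_has_vector_derivative) (auto intro: continuous_on_subset)
  moreover have "at t within {0..t + 1} = at t within {0..}"
    using t by (intro at_within_nhd[of t "{..<t + 1}"]) auto
  ultimately have "((\<lambda>t. integral {0..t} v) has_vector_derivative v t) (at t within {0..})" by simp
  from bounded_linear.has_vector_derivative[OF bounded_linear_replicate this]
  have "((\<lambda>t. followers (ps 0) + (\<chi> i. integral {0..t} v)) has_vector_derivative 0 + (\<chi> i. v t)) (at t within {0..})"
    by (intro has_vector_derivative_add has_vector_derivative_const)
  then have "((\<lambda>t. followers (ps 0) + (\<chi> i. integral {0..t} v)) has_vector_derivative (\<chi> i. v t)) (at t within {0..})"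
    by simp
  then show ?thesis
    by (rule has_vector_derivative_transform[rotated 2]) (use t in \<open>auto intro: followers_target\<close>)
qed

text \<open>Speed bound for the error when the gains have norm at most \<open>\<Gamma>\<close>: the
  bound for the follower velocities plus that for the target.\<close>

definition M :: "real \<Rightarrow> real" where
  "M \<Gamma> = real CARD('f) * (real CARD('l + 'f) * ((\<Gamma> + 1) * real (2 * CARD('d))) + B) + real CARD('f) * B"

lemma norm_replicate_le: "norm ((\<chi> i. c) :: real^'d^'f) \<le> CARD('f) * norm c"
  using norm_vec_le_sum[of "(\<chi> i. c) :: real^'d^'f"] by simp

text \<open>Collects what the inclusion yields at almost every time, so that the later arguments can
  do without the set-valued map.\<close>

definition velocity :: "real \<Rightarrow> real^'d^'f \<Rightarrow> real^'m \<Rightarrow> bool" where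
  "velocity t y' g' \<longleftrightarrow>
      (y has_vector_derivative y') (at t within {0..}) \<and> (\<gamma> has_vector_derivative g') (at t within {0..}) \<and>
      (\<forall>k. g' $ k = \<kappa> * norm1 (q t k)) \<and>
      y t \<bullet> y' \<le> (\<Sum>k\<in>UNIV. (\<gamma>0 - \<gamma> t $ k) * norm1 (q t k)) \<and>
      (\<forall>\<Gamma>. norm (\<gamma> t) \<le> \<Gamma> \<longrightarrow> norm y' \<le> M \<Gamma>)"

text \<open>In the error dynamics the target velocity joins the disturbance, and
  \<open>disturbance_le\<close> absorbs both into the edge sum.\<close>

lemma AE_dynamics:
  "AE t in lebesgue. t \<ge> 0 \<longrightarrow> (\<exists>y' g'. velocity t y' g')"
proof -
  let ?x = "\<lambda>t. (followers (p t), \<gamma> t)"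
  have "AE t in lebesgue. t \<ge> 0 \<longrightarrow>
      (\<exists>x'. (?x has_vector_derivative x') (at t within {0..}) \<and> x' \<in> filippov_map (closed_loop e ps d \<kappa>) t (?x t))"
    using solution by (simp add: filippov_solution_def)
  then show ?thesis
  proof (rule AE_mp, intro AE_I2 impI)
    fix t :: real assume t: "t \<ge> 0"
    assume "t \<ge> 0 \<longrightarrow> (\<exists>x'. (?x has_vector_derivative x') (at t within {0..}) \<and>
        x' \<in> filippov_map (closed_loop e ps d \<kappa>) t (?x t))"
    with t obtain x' where der: "(?x has_vector_derivative x') (at t within {0..})"
      and x': "x' \<in> filippov_map (closed_loop e ps d \<kappa>) t (?x t)" by blast
    have p': "((\<lambda>t. followers (p t)) has_vector_derivative fst x') (at t within {0..})"
      and g': "(\<gamma> has_vector_derivative snd x') (at t within {0..})"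
      using bounded_linear.has_vector_derivative[OF bounded_linear_fst der]
        bounded_linear.has_vector_derivative[OF bounded_linear_snd der] by simp_all
    have y': "(y has_vector_derivative fst x' - (\<chi> i. v t)) (at t within {0..})"
      unfolding y_def[abs_def] by (intro has_vector_derivative_diff p' followers_target_derivative t)
    have qt: "edge_displacement e (ps 0) (configuration (ps t) (fst (?x t))) k =
        edge_displacement e (ps 0) (configuration 0 (y t)) k" for k
      using edge_displacement_state[OF t, of k] by (simp add: q_def)
    note F = filippov_closed_loop[OF simple x' qt, folded q_def]
    have "y t \<bullet> (fst x' - (\<chi> i. v t)) =
        - (\<Sum>k\<in>UNIV. \<gamma> t $ k * norm1 (q t k)) + (y t \<bullet> followers (d t) - y t \<bullet> (\<chi> i. v t))"
      using F(1) by (simp add: inner_diff_right)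
    also have "\<dots> \<le> - (\<Sum>k\<in>UNIV. \<gamma> t $ k * norm1 (q t k)) + \<gamma>0 * (\<Sum>k\<in>UNIV. norm1 (q t k))"
      by (intro add_left_mono disturbance_le t)
    also have "\<dots> = (\<Sum>k\<in>UNIV. (\<gamma>0 - \<gamma> t $ k) * norm1 (q t k))"
      by (simp add: left_diff_distrib sum_subtractf sum_distrib_left)
    finally have diss: "y t \<bullet> (fst x' - (\<chi> i. v t)) \<le> (\<Sum>k\<in>UNIV. (\<gamma>0 - \<gamma> t $ k) * norm1 (q t k))" .
    have bound: "norm (fst x' - (\<chi> i. v t)) \<le> M \<Gamma>" if "norm (\<gamma> t) \<le> \<Gamma>" for \<Gamma>
    proof -
      have "norm (fst x') \<le> real CARD('f) * (real CARD('l + 'f) * ((\<Gamma> + 1) * real (2 * CARD('d))) + B)"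
        using x' that norm_le_B(2)[OF t] by (intro filippov_closed_loop_norm_le) auto
      moreover have "norm ((\<chi> i. v t) :: real^'d^'f) \<le> CARD('f) * B"
        using norm_replicate_le[of "v t"] mult_left_mono[OF norm_le_B(1)[OF t], of "real CARD('f)"] by linarith
      ultimately show ?thesis
        unfolding M_def using norm_triangle_ineq4[of "fst x'" "\<chi> i. v t"] by linarith
    qed
    show "\<exists>y' g'. velocity t y' g'" unfolding velocity_def
      using y' g' F(2) diss bound by blast
  qed
qed

section \<open>Absolute continuity and growth of the gains\<close>

lemma abs_continuous_pair: "abs_continuous_on_Icc 0 b (\<lambda>t. (y t, \<gamma> t))"
proof (cases "b \<ge> 0")
  case True
  let ?x = "\<lambda>t. (followers (p t), \<gamma> t)"
  have ac: "abs_continuous_on_Icc 0 b ?x" using solution True by (simp add: filippov_solution_def)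
  have "CARD('f) * B \<ge> 0" using B_nonneg by simp
  show ?thesis
  proof (rule abs_continuous_on_Icc_dominated[OF ac, of _ "1 + CARD('f) * B"])
    fix s t :: real assume st: "0 \<le> s" "s \<le> t" "t \<le> b"
    have "followers (ps t) - followers (ps s) = (\<chi> i. integral {0..t} v - integral {0..s} v)"
      using st by (simp add: followers_target[of t] followers_target[of s] vec_eq_iff)
    then have "norm (followers (ps t) - followers (ps s)) \<le> CARD('f) * norm (integral {0..t} v - integral {0..s} v)"
      using norm_replicate_le[of "integral {0..t} v - integral {0..s} v"] by simp
    also have "\<dots> \<le> CARD('f) * (B * (t - s))"
      by (rule mult_left_mono[OF integral_v_lipschitz[OF st(1,2)]]) simp
    finally have "norm (followers (ps t) - followers (ps s)) \<le> CARD('f) * (B * (t - s))" .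
    then have target_le: "norm (followers (ps t) - followers (ps s), 0 :: real^'m) \<le> CARD('f) * B * (t - s)"
      by (simp add: norm_Pair mult.assoc)
    have "norm ((y t, \<gamma> t) - (y s, \<gamma> s)) = norm ((?x t - ?x s) - (followers (ps t) - followers (ps s), 0))"
      by (simp add: y_def algebra_simps)
    also have "\<dots> \<le> norm (?x t - ?x s) + norm (followers (ps t) - followers (ps s), 0 :: real^'m)"
      by (rule norm_triangle_ineq4)
    also have "\<dots> \<le> norm (?x t - ?x s) + CARD('f) * B * (t - s)"
      by (rule add_left_mono[OF target_le])
    also have "\<dots> \<le> (1 + CARD('f) * B) * (norm (?x t - ?x s) + (t - s))"
    proof -
      have "n + c * h \<le> (1 + c) * (n + h)" if "0 \<le> n" "0 \<le> h" "0 \<le> c" for n h c :: real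
        using that by (simp add: algebra_simps)
      then show ?thesis using st \<open>CARD('f) * B \<ge> 0\<close> by simp
    qed
    finally show "norm ((y t, \<gamma> t) - (y s, \<gamma> s)) \<le> (1 + CARD('f) * B) * (norm (?x t - ?x s) + (t - s))" .
  qed
next
  \<comment> \<open>For negative \<open>b\<close> no interval is admissible, so only the empty
    family remains.\<close>
  case False
  show ?thesis unfolding abs_continuous_on_Icc_def
  proof (intro allI impI exI[of _ 1] conjI zero_less_one)
    fix \<epsilon> :: real and I :: "(real \<times> real) set"
    assume "\<epsilon> > 0" and "finite I \<and> (\<forall>(s, t)\<in>I. 0 \<le> s \<and> s \<le> t \<and> t \<le> b) \<and>
      pairwise (\<lambda>(s, t) (s', t'). {s<..<t} \<inter> {s'<..<t'} = {}) I \<and> (\<Sum>(s, t)\<in>I. t - s) < 1"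
    then have "I = {}" using False by fastforce
    with \<open>\<epsilon> > 0\<close> show "(\<Sum>(s, t)\<in>I. norm ((y t, \<gamma> t) - (y s, \<gamma> s))) < \<epsilon>" by simp
  qed
qed

lemma abs_continuous_y: "0 \<le> a \<Longrightarrow> abs_continuous_on_Icc a b y"
proof (rule abs_continuous_on_Icc_subinterval[OF abs_continuous_on_Icc_dominated[OF abs_continuous_pair]])
  fix s t :: real assume "s \<le> t"
  then show "norm (y t - y s) \<le> 1 * (norm ((y t, \<gamma> t) - (y s, \<gamma> s)) + (t - s))"
    using norm_fst_le[of "y t - y s" "\<gamma> t - \<gamma> s"] by simp
qed auto

lemma abs_continuous_gain: "0 \<le> a \<Longrightarrow> abs_continuous_on_Icc a b (\<lambda>t. w \<bullet> \<gamma> t)"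
proof (rule abs_continuous_on_Icc_subinterval[OF abs_continuous_on_Icc_dominated[OF abs_continuous_pair]])
  fix s t :: real assume "s \<le> t"
  have "norm (w \<bullet> \<gamma> t - w \<bullet> \<gamma> s) \<le> norm w * norm (\<gamma> t - \<gamma> s)"
    using Cauchy_Schwarz_ineq2[of w "\<gamma> t - \<gamma> s"] by (simp add: inner_diff_right)
  also have "\<dots> \<le> norm w * (norm ((y t, \<gamma> t) - (y s, \<gamma> s)) + (t - s))"
    using norm_snd_le[of "\<gamma> t - \<gamma> s" "y t - y s"] \<open>s \<le> t\<close> by (intro mult_left_mono) auto
  finally show "norm (w \<bullet> \<gamma> t - w \<bullet> \<gamma> s) \<le> norm w * (norm ((y t, \<gamma> t) - (y s, \<gamma> s)) + (t - s))" .
qed auto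

text \<open>The increment bound applied to \<open>- w\<close>. A unit vector as \<open>w\<close>
  gives the growth of one gain, the all-ones vector that of the total gain.\<close>

lemma gain_increment_ge:
  assumes ab: "0 \<le> a" "a \<le> b"
    and low: "\<And>t. t \<in> {a..b} \<Longrightarrow> c \<le> \<kappa> * (\<Sum>k\<in>UNIV. w $ k * norm1 (q t k))"
  shows "c * (b - a) \<le> w \<bullet> \<gamma> b - w \<bullet> \<gamma> a"
proof -
  have "(- w) \<bullet> \<gamma> b - (- w) \<bullet> \<gamma> a \<le> (- c) * (b - a)"
  proof (rule abs_continuous_increment_le[OF ab(2) abs_continuous_gain[OF ab(1)]])
    show "AE t in lebesgue. t \<in> {a..b} \<longrightarrow>
        (\<exists>f'\<le>- c. ((\<lambda>t. - w \<bullet> \<gamma> t) has_real_derivative f') (at t within {a..b}))"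
      using AE_dynamics
    proof (rule AE_mp, intro AE_I2 impI)
      fix t assume t: "t \<in> {a..b}"
      assume "t \<ge> 0 \<longrightarrow> (\<exists>y' g'. velocity t y' g')"
      with t ab obtain g' where g': "(\<gamma> has_vector_derivative g') (at t within {0..})"
        "\<And>k. g' $ k = \<kappa> * norm1 (q t k)" unfolding velocity_def by auto
      have "(\<gamma> has_vector_derivative g') (at t within {a..b})"
        using g'(1) ab by (auto intro: has_vector_derivative_within_subset)
      from bounded_linear.has_vector_derivative[OF bounded_linear_inner_right[of "- w"] this]
      have "((\<lambda>t. - w \<bullet> \<gamma> t) has_real_derivative - w \<bullet> g') (at t within {a..b})"
        by (simp add: has_real_derivative_iff_has_vector_derivative)
      moreover have "w \<bullet> g' = \<kappa> * (\<Sum>k\<in>UNIV. w $ k * norm1 (q t k))"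
        by (simp add: inner_vec_def g'(2) sum_distrib_left mult_ac)
      then have "- w \<bullet> g' \<le> - c" using low[OF t] by simp
      ultimately show "\<exists>f'\<le>- c. ((\<lambda>t. - w \<bullet> \<gamma> t) has_real_derivative f') (at t within {a..b})" by blast
    qed
  qed
  then show ?thesis by simp
qed

text \<open>Half of its squared norm is the Lyapunov function; shifting the gains by \<open>\<gamma>0\<close> cancels the disturbance.\<close>

definition lyap :: "real \<Rightarrow> (real^'d^'f) \<times> (real^'m)" where
  "lyap t = (y t, (1 / sqrt \<kappa>) *\<^sub>R (\<gamma> t - (\<chi> k. \<gamma>0)))"

text \<open>The factor \<open>1 / sqrt \<kappa>\<close>, squared by the inner product, cancels the
  adaptation rate; the gain term is then exactly the negative of the bound for
  \<open>y s \<bullet> y'\<close>.\<close>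

lemma norm_lyap_nonincreasing:
  assumes "0 \<le> t"
  shows "norm (lyap t) \<le> norm (lyap 0)"
proof (rule abs_continuous_norm_nonincreasing[OF assms])
  show "abs_continuous_on_Icc 0 t lyap"
  proof (rule abs_continuous_on_Icc_dominated[OF abs_continuous_pair, of _ _ "1 + 1 / sqrt \<kappa>"])
    fix s r :: real assume "s \<le> r"
    let ?n = "norm ((y r, \<gamma> r) - (y s, \<gamma> s)) + (r - s)"
    have "norm (lyap r - lyap s) = norm (y r - y s, (1 / sqrt \<kappa>) *\<^sub>R (\<gamma> r - \<gamma> s))"
      by (simp add: lyap_def scaleR_right_diff_distrib)
    also have "\<dots> \<le> norm (y r - y s) + (1 / sqrt \<kappa>) * norm (\<gamma> r - \<gamma> s)"
      using norm_Pair_le[of "y r - y s" "(1 / sqrt \<kappa>) *\<^sub>R (\<gamma> r - \<gamma> s)"] \<kappa>_pos by simp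
    also have "\<dots> \<le> ?n + (1 / sqrt \<kappa>) * ?n"
      using norm_fst_le[of "y r - y s" "\<gamma> r - \<gamma> s"] norm_snd_le[of "\<gamma> r - \<gamma> s" "y r - y s"] \<open>s \<le> r\<close> \<kappa>_pos
      by (intro add_mono mult_left_mono) auto
    finally show "norm (lyap r - lyap s) \<le> (1 + 1 / sqrt \<kappa>) * ?n" by (simp only: distrib_right mult_1)
  qed
  show "AE s in lebesgue. s \<in> {0..t} \<longrightarrow>
      (\<exists>x'. (lyap has_vector_derivative x') (at s within {0..t}) \<and> lyap s \<bullet> x' \<le> 0)"
    using AE_dynamics
  proof (rule AE_mp, intro AE_I2 impI)
    fix s assume s: "s \<in> {0..t}"
    assume "s \<ge> 0 \<longrightarrow> (\<exists>y' g'. velocity s y' g')"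
    with s obtain y' g' where y': "(y has_vector_derivative y') (at s within {0..})"
      and g': "(\<gamma> has_vector_derivative g') (at s within {0..})" "\<And>k. g' $ k = \<kappa> * norm1 (q s k)"
      and diss: "y s \<bullet> y' \<le> (\<Sum>k\<in>UNIV. (\<gamma>0 - \<gamma> s $ k) * norm1 (q s k))" unfolding velocity_def by auto
    \<comment> \<open>\<open>g' - 0\<close> is the form that the differentiation rule produces for
      the constant shift of the gains.\<close>
    let ?l = "(y', (1 / sqrt \<kappa>) *\<^sub>R (g' - 0))"
    have "(lyap has_vector_derivative ?l) (at s within {0..})"
      unfolding lyap_def[abs_def]
      by (intro has_vector_derivative_Pair y' bounded_linear.has_vector_derivative[OF bounded_linear_scaleR_right]
          has_vector_derivative_diff g'(1) has_vector_derivative_const)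
    then have "(lyap has_vector_derivative ?l) (at s within {0..t})"
      by (rule has_vector_derivative_within_subset) auto
    moreover have "lyap s \<bullet> ?l \<le> 0"
    proof -
      have "lyap s \<bullet> ?l = y s \<bullet> y' + (1 / \<kappa>) * ((\<gamma> s - (\<chi> k. \<gamma>0)) \<bullet> g')"
        using \<kappa>_pos by (simp add: lyap_def)
      also have "(\<gamma> s - (\<chi> k. \<gamma>0)) \<bullet> g' = \<kappa> * (\<Sum>k\<in>UNIV. (\<gamma> s $ k - \<gamma>0) * norm1 (q s k))"
        by (simp add: inner_vec_def g'(2) sum_distrib_left mult_ac)
      also have "(1 / \<kappa>) * \<dots> = - (\<Sum>k\<in>UNIV. (\<gamma>0 - \<gamma> s $ k) * norm1 (q s k))"
        using \<kappa>_pos by (simp add: sum_negf[symmetric] left_diff_distrib)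
      finally show ?thesis using diss by simp
    qed
    ultimately show "\<exists>x'. (lyap has_vector_derivative x') (at s within {0..t}) \<and> lyap s \<bullet> x' \<le> 0" by blast
  qed
qed

section \<open>Convergence of the gains and of the error\<close>

lemma gain_bounded:
  obtains \<Gamma> where "\<And>t. t \<ge> 0 \<Longrightarrow> norm (\<gamma> t) \<le> \<Gamma>"
proof
  fix t :: real assume "t \<ge> 0"
  have "norm ((1 / sqrt \<kappa>) *\<^sub>R (\<gamma> t - (\<chi> k. \<gamma>0))) \<le> norm (lyap 0)"
    using norm_snd_le[of "(1 / sqrt \<kappa>) *\<^sub>R (\<gamma> t - (\<chi> k. \<gamma>0))" "y t"] norm_lyap_nonincreasing[OF \<open>t \<ge> 0\<close>]
    unfolding lyap_def[of t] by linarith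
  then have "norm (\<gamma> t - (\<chi> k. \<gamma>0)) \<le> sqrt \<kappa> * norm (lyap 0)"
    unfolding norm_scaleR using \<kappa>_pos by (simp add: pos_divide_le_eq mult.commute)
  then show "norm (\<gamma> t) \<le> norm ((\<chi> k. \<gamma>0) :: real^'m) + sqrt \<kappa> * norm (lyap 0)"
    using norm_triangle_sub[of "\<gamma> t" "\<chi> k. \<gamma>0"] by linarith
qed

lemma gain_mono:
  assumes "0 \<le> s" "s \<le> t"
  shows "\<gamma> s $ k \<le> \<gamma> t $ k"
proof -
  have "0 \<le> \<kappa> * (\<Sum>j\<in>UNIV. axis k 1 $ j * norm1 (q r j))" for r
    using \<kappa>_pos by (intro mult_nonneg_nonneg sum_nonneg) (auto simp: axis_def)
  then have "0 * (t - s) \<le> axis k 1 \<bullet> \<gamma> t - axis k 1 \<bullet> \<gamma> s"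
    by (intro gain_increment_ge assms)
  then show ?thesis by (simp add: inner_axis')
qed

lemma gain_convergent: "\<exists>\<gamma>s. (\<gamma> \<longlongrightarrow> \<gamma>s) at_top"
proof -
  obtain \<Gamma> where \<Gamma>: "\<And>t. t \<ge> 0 \<Longrightarrow> norm (\<gamma> t) \<le> \<Gamma>" using gain_bounded by blast
  have "\<exists>l. ((\<lambda>t. \<gamma> t $ k) \<longlongrightarrow> l) at_top" for k
  proof (rule increasing_bounded_tendsto[of "\<lambda>t. \<gamma> t $ k" \<Gamma>])
    show "\<gamma> s $ k \<le> \<gamma> t $ k" if "0 \<le> s" "s \<le> t" for s t using that by (rule gain_mono)
    show "\<gamma> t $ k \<le> \<Gamma>" if "t \<ge> 0" for t
      using component_le_norm_cart[of "\<gamma> t" k] \<Gamma>[OF that] by linarith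
  qed blast
  then obtain l where "\<And>k. ((\<lambda>t. \<gamma> t $ k) \<longlongrightarrow> l k) at_top" by metis
  then have "(\<gamma> \<longlongrightarrow> (\<chi> k. l k)) at_top" by (intro vec_tendstoI) simp
  then show ?thesis by blast
qed

text \<open>Bounded gains turn \<open>M\<close> into a uniform speed bound.\<close>

lemma y_lipschitz:
  obtains L where "\<And>s t. 0 \<le> s \<Longrightarrow> s \<le> t \<Longrightarrow> norm (y t - y s) \<le> L * (t - s)"
proof -
  obtain \<Gamma> where \<Gamma>: "\<And>t. t \<ge> 0 \<Longrightarrow> norm (\<gamma> t) \<le> \<Gamma>" using gain_bounded by blast
  have "\<Gamma> \<ge> 0" using \<Gamma>[of 0] norm_ge_zero[of "\<gamma> 0"] by linarith
  then have "M \<Gamma> \<ge> 0" using B_nonneg unfolding M_def by (intro add_nonneg_nonneg mult_nonneg_nonneg) auto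
  have "norm (y t - y s) \<le> M \<Gamma> * (t - s)" if st: "0 \<le> s" "s \<le> t" for s t
  proof (rule abs_continuous_norm_increment_le[OF st(2) \<open>M \<Gamma> \<ge> 0\<close> abs_continuous_y[OF st(1)]])
    show "AE r in lebesgue. r \<in> {s..t} \<longrightarrow>
        (\<exists>x'. (y has_vector_derivative x') (at r within {s..t}) \<and> norm x' \<le> M \<Gamma>)"
      using AE_dynamics
    proof (rule AE_mp, intro AE_I2 impI)
      fix r assume r: "r \<in> {s..t}"
      assume "r \<ge> 0 \<longrightarrow> (\<exists>y' g'. velocity r y' g')"
      with r st \<Gamma>[of r] obtain y' where y': "(y has_vector_derivative y') (at r within {0..})" "norm y' \<le> M \<Gamma>"
        unfolding velocity_def by auto
      have "(y has_vector_derivative y') (at r within {s..t})"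
        using y'(1) st by (auto intro: has_vector_derivative_within_subset)
      with y'(2) show "\<exists>x'. (y has_vector_derivative x') (at r within {s..t}) \<and> norm x' \<le> M \<Gamma>" by blast
    qed
  qed
  then show ?thesis using that by blast
qed

text \<open>The total gain plays the role of \<open>G\<close>: it converges, and by
  \<open>norm_y_le\<close> it grows at rate at least
  \<open>\<kappa> * sqrt \<mu> * \<epsilon>\<close> while the error has norm at least
  \<open>\<epsilon>\<close>.\<close>

lemma y_tendsto_0: "(y \<longlongrightarrow> 0) at_top"
proof -
  obtain L where L: "\<And>s t. 0 \<le> s \<Longrightarrow> s \<le> t \<Longrightarrow> norm (y t - y s) \<le> L * (t - s)" using y_lipschitz by blast
  obtain \<gamma>s where \<gamma>s: "(\<gamma> \<longlongrightarrow> \<gamma>s) at_top" using gain_convergent by blast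
  let ?w = "(\<chi> k. 1) :: real^'m"
  show ?thesis
  proof (rule tendsto_zero_of_dissipation[where G = "\<lambda>t. ?w \<bullet> \<gamma> t" and c = "\<kappa> * sqrt \<mu>"])
    show "((\<lambda>t. ?w \<bullet> \<gamma> t) \<longlongrightarrow> ?w \<bullet> \<gamma>s) at_top" using \<gamma>s by (intro tendsto_intros)
    show "\<kappa> * sqrt \<mu> > 0" using \<kappa>_pos \<mu>_pos by simp
    show "(\<kappa> * sqrt \<mu>) * \<epsilon> * (b - a) \<le> ?w \<bullet> \<gamma> b - ?w \<bullet> \<gamma> a"
      if ab: "0 \<le> a" "a \<le> b" and low: "\<And>t. t \<in> {a..b} \<Longrightarrow> \<epsilon> \<le> norm (y t)" for a b \<epsilon>
    proof (rule gain_increment_ge[OF ab])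
      fix t assume "t \<in> {a..b}"
      have "sqrt \<mu> * \<epsilon> \<le> sqrt \<mu> * norm (y t)" using low[OF \<open>t \<in> {a..b}\<close>] \<mu>_pos by (intro mult_left_mono) auto
      also note norm_y_le
      finally show "\<kappa> * sqrt \<mu> * \<epsilon> \<le> \<kappa> * (\<Sum>k\<in>UNIV. ?w $ k * norm1 (q t k))"
        using \<kappa>_pos by simp
    qed
  qed (fact L)
qed

text \<open>Once all gains exceed the threshold by a fixed \<open>c\<close>, the surplus
  \<open>c\<close> times the edge sum dominates a multiple of \<open>norm (y t)\<close>.\<close>

lemma y_finite_time:
  assumes lim: "(\<gamma> \<longlongrightarrow> \<gamma>s) at_top" and above: "\<And>k. \<gamma>s $ k > \<gamma>0"
  shows "\<exists>T\<ge>0. \<forall>t\<ge>T. y t = 0"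
proof -
  \<comment> \<open>Half of the smallest margin of the limit gains; the other half leaves room for
    the convergence.\<close>
  define c where "c = Min (range (\<lambda>k. \<gamma>s $ k - \<gamma>0)) / 2"
  have c: "c > 0" using above by (auto simp: c_def)
  have c_le: "2 * c \<le> \<gamma>s $ k - \<gamma>0" for k by (simp add: c_def)
  have "eventually (\<lambda>t. \<forall>k. \<gamma> t $ k > \<gamma>0 + c) at_top"
  proof (rule eventually_all_finite)
    fix k
    have "((\<lambda>t. \<gamma> t $ k) \<longlongrightarrow> \<gamma>s $ k) at_top" using lim by (rule tendsto_vec_nth)
    then show "eventually (\<lambda>t. \<gamma> t $ k > \<gamma>0 + c) at_top" using c_le[of k] c by (intro order_tendstoD) auto
  qed
  then obtain T0 where T0: "\<And>t k. t \<ge> T0 \<Longrightarrow> \<gamma> t $ k > \<gamma>0 + c"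
    unfolding eventually_at_top_linorder by blast
  \<comment> \<open>The dynamics are known only at nonnegative times.\<close>
  define T where "T = max 0 T0"
  have T: "T \<ge> 0" "\<And>t k. t \<ge> T \<Longrightarrow> \<gamma> t $ k > \<gamma>0 + c" using T0 by (auto simp: T_def)
  have "\<exists>T'\<ge>T. \<forall>t\<ge>T'. y t = 0"
  proof (rule finite_time_convergence[where c = "c * sqrt \<mu>"])
    show "abs_continuous_on_Icc T b y" for b using T(1) by (rule abs_continuous_y)
    show "c * sqrt \<mu> > 0" using c \<mu>_pos by simp
    show "AE t in lebesgue. t \<ge> T \<longrightarrow>
      (\<exists>y'. (y has_vector_derivative y') (at t within {T..}) \<and> y t \<bullet> y' \<le> - (c * sqrt \<mu>) * norm (y t))"
      using AE_dynamics
    proof (rule AE_mp, intro AE_I2 impI)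
      fix t assume t: "t \<ge> T"
      assume "t \<ge> 0 \<longrightarrow> (\<exists>y' g'. velocity t y' g')"
      with t T(1) obtain y' where y': "(y has_vector_derivative y') (at t within {0..})"
        and diss: "y t \<bullet> y' \<le> (\<Sum>k\<in>UNIV. (\<gamma>0 - \<gamma> t $ k) * norm1 (q t k))" unfolding velocity_def by auto
      note diss
      also have "(\<Sum>k\<in>UNIV. (\<gamma>0 - \<gamma> t $ k) * norm1 (q t k)) \<le> (\<Sum>k\<in>UNIV. (- c) * norm1 (q t k))"
        using T(2)[OF t] by (intro sum_mono mult_right_mono) (auto simp: less_imp_le algebra_simps)
      also have "\<dots> = - (c * (\<Sum>k\<in>UNIV. norm1 (q t k)))" by (simp add: sum_distrib_left sum_negf)
      also have "\<dots> \<le> - (c * (sqrt \<mu> * norm (y t)))" using norm_y_le[of t] c by simp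
      finally have "y t \<bullet> y' \<le> - (c * sqrt \<mu>) * norm (y t)" by (simp add: mult.assoc)
      moreover have "(y has_vector_derivative y') (at t within {T..})"
        using y' T(1) by (auto intro: has_vector_derivative_within_subset)
      ultimately show "\<exists>y'. (y has_vector_derivative y') (at t within {T..}) \<and> y t \<bullet> y' \<le> - (c * sqrt \<mu>) * norm (y t)"
        by blast
    qed
  qed
  then obtain T' where T': "T' \<ge> T" "\<forall>t\<ge>T'. y t = 0" by blast
  from T'(1) T(1) have "T' \<ge> 0" by linarith
  with T'(2) show ?thesis by blast
qed

end

theorem theorem3:
  fixes e :: "'m::finite \<Rightarrow> ('l::finite + 'f::finite) \<times> ('l + 'f)"
    and v :: "real \<Rightarrow> real^'d"
    and ps p d \<delta> :: "real \<Rightarrow> real^'d^('l + 'f)"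
    and \<gamma> :: "real \<Rightarrow> real^'m"
    and \<kappa> \<beta> \<gamma>0 :: real
  assumes "CARD('d) \<ge> 2" and "CARD('l) \<ge> 2"
    and "simple_graph e"
    and target_distinct: "\<And>i j. i \<noteq> j \<Longrightarrow> ps 0 $ i \<noteq> ps 0 $ j"
    and target_rigid: "infinitesimally_bearing_rigid e (ps 0)"
    and v: "bounded (v ` {0..})" "uniformly_continuous_on {0..} v"
    and target: "\<And>t i. t \<ge> 0 \<Longrightarrow> ps t $ i = ps 0 $ i + integral {0..t} v"
    and leaders: "\<And>t i. t \<ge> 0 \<Longrightarrow> p t $ Inl i = ps t $ Inl i"
    and d: "bounded (d ` {0..})" "uniformly_continuous_on {0..} d"
    and \<beta>: "\<beta> = sup_infnorm d" "\<beta> > 0"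
    and no_collision: "\<And>t i j. t \<ge> 0 \<Longrightarrow> i \<noteq> j \<Longrightarrow> p t $ i \<noteq> p t $ j"
    and "\<kappa> > 0"
    and "\<And>k. \<gamma> 0 $ k > 0"
    and solution: "filippov_solution (closed_loop e ps d \<kappa>) (\<lambda>t. (followers (p t), \<gamma> t))"
    and \<delta>: "\<delta> = (\<lambda>t. p t - ps t)"
    and \<gamma>0: "\<gamma>0 = (\<beta> + sup_infnorm v) *
        sqrt (real (CARD('d) * CARD('l + 'f)) /
              lambda_min (follower_block (bearing_laplacian e (ps 0))))"
  shows "(\<delta> \<longlongrightarrow> 0) at_top \<and>
    (\<exists>\<gamma>s. (\<gamma> \<longlongrightarrow> \<gamma>s) at_top) \<and>
    (\<forall>\<gamma>s. (\<gamma> \<longlongrightarrow> \<gamma>s) at_top \<and> (\<forall>k. \<gamma>s $ k > \<gamma>0) \<and>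
        (\<exists>T\<ge>0. \<forall>k. \<bar>\<gamma> T $ k - \<gamma>s $ k\<bar> < Min (range (\<lambda>k'. \<bar>\<gamma> T $ k' - \<gamma>0\<bar>)))
      \<longrightarrow> (\<exists>T'\<ge>0. \<forall>t\<ge>T'. \<delta> t = 0))"
proof -
  interpret S: closed_loop_solution e v ps p d \<gamma> \<kappa>
  proof (rule closed_loop_solution.intro)
    show "continuous_on {0..} v" using v(2) by (rule uniformly_continuous_imp_continuous)
  qed (fact assms)+
  have \<gamma>0_eq: "S.\<gamma>0 = \<gamma>0" by (simp add: S.\<gamma>0_def S.\<mu>_def \<gamma>0 \<beta>(1))
  \<comment> \<open>The leaders sit at their targets, so the full error is the follower error
    extended by zero.\<close>
  have \<delta>_eq: "\<delta> t = configuration 0 (S.y t)" if "t \<ge> 0" for t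
  proof -
    have "\<delta> t $ i = configuration 0 (S.y t) $ i" for i
      using leaders[OF that] by (cases i) (simp_all add: \<delta> S.y_def followers_def)
    then show ?thesis by (simp add: vec_eq_iff)
  qed
  have "((\<lambda>t. configuration 0 (S.y t)) \<longlongrightarrow> (0 :: real^'d^('l + 'f))) at_top"
  proof (rule vec_tendstoI)
    fix i :: "'l + 'f"
    have "((\<lambda>t. S.y t $ j) \<longlongrightarrow> 0 $ j) at_top" for j by (rule tendsto_vec_nth[OF S.y_tendsto_0])
    then show "((\<lambda>t. configuration 0 (S.y t) $ i) \<longlongrightarrow> (0 :: real^'d^('l + 'f)) $ i) at_top" by (cases i) auto
  qed
  \<comment> \<open>The identification holds from time zero on, which suffices for a limit at
    infinity.\<close>
  moreover have "eventually (\<lambda>t. configuration 0 (S.y t) = \<delta> t) at_top"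
    using eventually_ge_at_top[of 0] by eventually_elim (simp add: \<delta>_eq)
  ultimately have "(\<delta> \<longlongrightarrow> 0) at_top" by (rule Lim_transform_eventually)
  moreover have "\<exists>T'\<ge>0. \<forall>t\<ge>T'. \<delta> t = 0" if lim: "(\<gamma> \<longlongrightarrow> \<gamma>s) at_top" "\<forall>k. \<gamma>s $ k > \<gamma>0" for \<gamma>s
  proof -
    obtain T where T: "T \<ge> 0" "\<And>t. t \<ge> T \<Longrightarrow> S.y t = 0"
      using S.y_finite_time[OF lim(1)] lim(2) unfolding \<gamma>0_eq by blast
    have "configuration 0 0 $ i = (0 :: real^'d^('l + 'f)) $ i" for i by (cases i) simp_all
    then have "configuration 0 0 = (0 :: real^'d^('l + 'f))" unfolding vec_eq_iff by blast
    then have "\<delta> t = 0" if "t \<ge> T" for t using \<delta>_eq[of t] T that by simp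
    with T(1) show ?thesis by blast
  qed
  ultimately show ?thesis using S.gain_convergent by blast
qed

end
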